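(* Let $n,m\ge 1$ and let $\varphi\colon \mathcal{T}_{n,m}\to M_m(\mathbb{C})$ be a unital completely positive (ucp) map. The following are equivalent. (i) $\varphi$ is pure. (ii) $\varphi$ has a unique ucp extension to $M_{mn}(\mathbb{C})$, and this extension is pure. (iii) There is an isometry $V=(V_1,V_2,\ldots,V_n)^t\colon \mathbb{C}^m\to\mathbb{C}^{mn}$, with blocks $V_i\in M_m(\mathbb{C})$, such that $\varphi(T)=V^*TV$ for all $T\in\mathcal{T}_{n,m}$, and such that the $M_m(\mathbb{C})$-valued polynomial $Q_V(z)=\sum_{i=1}^n z^{n-i}V_i$ has degree $n-1$ and has all its roots on the unit circle $\mathbb{T}$.
   Context: $\mathcal{T}_{n,m}\subset M_{mn}(\mathbb{C})=M_n(M_m(\mathbb{C}))$ is the operator system of all block Toeplitz matrices $T=(T_{i-j})_{i,j=1}^n$ with $T_k\in M_m(\mathbb{C})$ for $-(n-1)\le k\le n-1$. Here $(V_1,\ldots,V_n)^t$ denotes the $mn\times m$ block column with $m\times m$ blocks $V_1,\ldots,V_n$; it is an isometry if $\sum_i V_i^*V_i=I_m$. Pure: for an operator system $\mathcal{S}$, a ucp map $\phi\colon\mathcal{S}\to M_m(\mathbb{C})$ is pure if whenever $\psi\colon\mathcal{S}\to M_m(\mathbb{C})$ is completely positive and $\phi-\psi$ is completely positive, there is $t\in[0,1]$ with $\psi=t\phi$. Roots: a root of a matrix-valued polynomial $Q$ is a point $a\in\mathbb{C}$ such that $Q(a)$ is the zero matrix. The degree $n-1$ condition means $V_1\neq 0$.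 $\mathbb{T}=\{z\in\mathbb{C}:|z|=1\}$. *)

theory Defs
  imports "Jordan_Normal_Form.Schur_Decomposition" "HOL-Computational_Algebra.Polynomial"
begin

definition psd :: "nat \<Rightarrow> complex mat \<Rightarrow> bool" where
  "psd d A \<longleftrightarrow> A \<in> carrier_mat d d \<and> (\<forall>v\<in>carrier_vec d. 0 \<le> (A *\<^sub>v v) \<bullet>c v)"

(* Identifies M_k(M_d) with the (k*d) x (k*d) matrices; the blocks X i j are indexed by i, j < k. *)
definition block_mat :: "nat \<Rightarrow> nat \<Rightarrow> (nat \<Rightarrow> nat \<Rightarrow> complex mat) \<Rightarrow> complex mat" where
  "block_mat k d X =
     mat (k * d) (k * d) (\<lambda>(r, c). X (r div d) (c div d) $$ (r mod d, c mod d))"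

definition operator_system :: "nat \<Rightarrow> complex mat set \<Rightarrow> bool" where
  "operator_system d S \<longleftrightarrow>
     S \<subseteq> carrier_mat d d \<and> 1\<^sub>m d \<in> S \<and>
     (\<forall>X\<in>S. \<forall>Y\<in>S. X + Y \<in> S) \<and> (\<forall>a. \<forall>X\<in>S. a \<cdot>\<^sub>m X \<in> S) \<and>
     (\<forall>X\<in>S. mat_adjoint X \<in> S)"

(* A map on a subspace S of M_d(C) is represented by a total function of which only the values
   on S matter. *)
definition linear_map_on :: "complex mat set \<Rightarrow> nat \<Rightarrow> (complex mat \<Rightarrow> complex mat) \<Rightarrow> bool" where
  "linear_map_on S m \<phi> \<longleftrightarrow>
     (\<forall>X\<in>S. \<phi> X \<in> carrier_mat m m) \<and>
     (\<forall>X\<in>S. \<forall>Y\<in>S. \<phi> (X + Y) = \<phi> X + \<phi> Y) \<and>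
     (\<forall>a. \<forall>X\<in>S. \<phi> (a \<cdot>\<^sub>m X) = a \<cdot>\<^sub>m \<phi> X)"

definition completely_positive ::
    "nat \<Rightarrow> complex mat set \<Rightarrow> nat \<Rightarrow> (complex mat \<Rightarrow> complex mat) \<Rightarrow> bool" where
  "completely_positive d S m \<phi> \<longleftrightarrow>
     linear_map_on S m \<phi> \<and>
     (\<forall>k X. (\<forall>i<k. \<forall>j<k. X i j \<in> S) \<longrightarrow> psd (k * d) (block_mat k d X) \<longrightarrow>
        psd (k * m) (block_mat k m (\<lambda>i j. \<phi> (X i j))))"

definition ucp ::
    "nat \<Rightarrow> complex mat set \<Rightarrow> nat \<Rightarrow> (complex mat \<Rightarrow> complex mat) \<Rightarrow> bool" where
  "ucp d S m \<phi> \<longleftrightarrow> completely_positive d S m \<phi> \<and> \<phi> (1\<^sub>m d) = 1\<^sub>m m"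

(* Only applied to ucp maps \<phi>. *)
definition pure ::
    "nat \<Rightarrow> complex mat set \<Rightarrow> nat \<Rightarrow> (complex mat \<Rightarrow> complex mat) \<Rightarrow> bool" where
  "pure d S m \<phi> \<longleftrightarrow>
     (\<forall>\<psi>. completely_positive d S m \<psi> \<and> completely_positive d S m (\<lambda>X. \<phi> X - \<psi> X) \<longrightarrow>
        (\<exists>t::real. 0 \<le> t \<and> t \<le> 1 \<and> (\<forall>X\<in>S. \<psi> X = complex_of_real t \<cdot>\<^sub>m \<phi> X)))"

(* Block indices start at 0 here, which does not affect the differences i - j. *)
definition block_toeplitz :: "nat \<Rightarrow> nat \<Rightarrow> complex mat set" where
  "block_toeplitz n m =
     {block_mat n m (\<lambda>i j. T (int i - int j)) | T.
        \<forall>k. - (int n - 1) \<le> k \<and> k \<le> int n - 1 \<longrightarrow> T k \<in> carrier_mat m m}"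

(* The column (V_1, ..., V_n)^t; unlike the blocks of block_mat, the V_i are indexed from 1. *)
definition block_col :: "nat \<Rightarrow> nat \<Rightarrow> (nat \<Rightarrow> complex mat) \<Rightarrow> complex mat" where
  "block_col n m V = mat (n * m) m (\<lambda>(r, c). V (r div m + 1) $$ (r mod m, c))"

definition isometry :: "complex mat \<Rightarrow> bool" where
  "isometry W \<longleftrightarrow> mat_adjoint W * W = 1\<^sub>m (dim_col W)"

(* Matrix-valued polynomials are matrices over complex poly. *)
definition Q_poly :: "nat \<Rightarrow> nat \<Rightarrow> (nat \<Rightarrow> complex mat) \<Rightarrow> complex poly mat" where
  "Q_poly n m V = mat m m (\<lambda>(a, b). \<Sum>i=1..n. monom (V i $$ (a, b)) (n - i))"

definition eval_matpoly :: "complex poly mat \<Rightarrow> complex \<Rightarrow> complex mat" where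
  "eval_matpoly Q z = map_mat (\<lambda>p. poly p z) Q"

definition coeff_matpoly :: "complex poly mat \<Rightarrow> nat \<Rightarrow> complex mat" where
  "coeff_matpoly Q k = map_mat (\<lambda>p. coeff p k) Q"

definition has_degree :: "complex poly mat \<Rightarrow> nat \<Rightarrow> bool" where
  "has_degree Q d \<longleftrightarrow>
     coeff_matpoly Q d \<noteq> 0\<^sub>m (dim_row Q) (dim_col Q) \<and>
     (\<forall>k>d. coeff_matpoly Q k = 0\<^sub>m (dim_row Q) (dim_col Q))"

definition matpoly_roots :: "complex poly mat \<Rightarrow> complex set" where
  "matpoly_roots Q = {a. eval_matpoly Q a = 0\<^sub>m (dim_row Q) (dim_col Q)}"

lemma coeff_Q_poly:
  assumes "a < m" "b < m"
  shows "coeff (Q_poly n m V $$ (a, b)) k = (if k < n then V (n - k) $$ (a, b) else 0)"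
proof -
  have "coeff (Q_poly n m V $$ (a, b)) k = (\<Sum>i=1..n. if n - i = k then V i $$ (a, b) else 0)"
    using assms by (simp add: Q_poly_def coeff_sum)
  also have "\<dots> = (\<Sum>i=1..n. if i = n - k \<and> k < n then V i $$ (a, b) else 0)"
    by (intro sum.cong) auto
  also have "\<dots> = (if k < n then V (n - k) $$ (a, b) else 0)"
    by (cases "k < n") auto
  finally show ?thesis .
qed

lemma has_degree_Q_poly_iff:
  assumes "1 \<le> n" "V 1 \<in> carrier_mat m m"
  shows "has_degree (Q_poly n m V) (n - 1) \<longleftrightarrow> V 1 \<noteq> 0\<^sub>m m m"
proof -
  have dim: "dim_row (Q_poly n m V) = m" "dim_col (Q_poly n m V) = m"
    by (simp_all add: Q_poly_def)
  have 1: "coeff_matpoly (Q_poly n m V) (n - 1) = V 1"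
    using assms dim by (intro eq_matI) (auto simp: coeff_matpoly_def coeff_Q_poly)
  have 2: "coeff_matpoly (Q_poly n m V) k = 0\<^sub>m m m" if "k > n - 1" for k
    using that assms dim by (intro eq_matI) (auto simp: coeff_matpoly_def coeff_Q_poly)
  show ?thesis
    unfolding has_degree_def dim using 1 2 by simp
qed

lemma eval_Q_poly:
  assumes "a < m" "b < m"
  shows "eval_matpoly (Q_poly n m V) z $$ (a, b) = (\<Sum>i=1..n. z ^ (n - i) * V i $$ (a, b))"
  using assms by (simp add: eval_matpoly_def Q_poly_def poly_sum poly_monom mult.commute)

lemma mat_adjoint_index:
  assumes "i < dim_col A" "j < dim_row A"
  shows "mat_adjoint A $$ (i, j) = cnj (A $$ (j, i))"
  using assms by (simp add: mat_adjoint_def mat_of_rows_def)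

lemma mat_adjoint_dim: "dim_row (mat_adjoint A) = dim_col A" "dim_col (mat_adjoint A) = dim_row A"
  by (simp_all add: mat_adjoint_def)

lemma sum_div_mod:
  fixes f :: "nat \<Rightarrow> nat \<Rightarrow> complex"
  assumes "0 < m"
  shows "(\<Sum>r<n * m. f (r div m) (r mod m)) = (\<Sum>i<n. \<Sum>s<m. f i s)"
proof -
  have "(\<Sum>r<n * m. f (r div m) (r mod m)) =
      (\<Sum>i<n. \<Sum>r=i * m..<i * m + m. f (r div m) (r mod m))"
    by (simp only: sum.nat_group)
  also have "\<dots> = (\<Sum>i<n. \<Sum>s<m. f i s)"
  proof (rule sum.cong[OF refl])
    fix i
    show "(\<Sum>r=i * m..<i * m + m. f (r div m) (r mod m)) = (\<Sum>s<m. f i s)"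
      using assms
      by (intro sum.reindex_bij_witness[of _ "\<lambda>s. i * m + s" "\<lambda>r. r - i * m"])
         (auto simp: le_iff_add)
  qed
  finally show ?thesis .
qed

lemma isometry_block_col_iff:
  assumes V: "\<And>i. i \<in> {1..n} \<Longrightarrow> V i \<in> carrier_mat m m"
  shows "isometry (block_col n m V) \<longleftrightarrow>
    (\<forall>a<m. \<forall>b<m. (\<Sum>i=1..n. (mat_adjoint (V i) * V i) $$ (a, b)) = 1\<^sub>m m $$ (a, b))"
proof -
  let ?W = "block_col n m V"
  have dim: "dim_row ?W = n * m" "dim_col ?W = m" by (simp_all add: block_col_def)
  have entry: "(mat_adjoint ?W * ?W) $$ (a, b) =
      (\<Sum>i=1..n. (mat_adjoint (V i) * V i) $$ (a, b))" if ab: "a < m" "b < m" for a b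
  proof -
    have "(mat_adjoint ?W * ?W) $$ (a, b) = (\<Sum>r<n * m. cnj (?W $$ (r, a)) * ?W $$ (r, b))"
      using ab by (simp add: scalar_prod_def dim mat_adjoint_dim mat_adjoint_index lessThan_atLeast0)
    also have "\<dots> = (\<Sum>r<n * m. (\<lambda>i s. cnj (V (i + 1) $$ (s, a)) * V (i + 1) $$ (s, b)) (r div m) (r mod m))"
      using ab by (intro sum.cong) (auto simp: block_col_def)
    also have "\<dots> = (\<Sum>i<n. \<Sum>s<m. cnj (V (i + 1) $$ (s, a)) * V (i + 1) $$ (s, b))"
      using ab by (subst sum_div_mod) auto
    also have "\<dots> = (\<Sum>i<n. (mat_adjoint (V (Suc i)) * V (Suc i)) $$ (a, b))"
    proof (intro sum.cong refl)
      fix i assume "i \<in> {..<n}"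
      then have "V (Suc i) \<in> carrier_mat m m" using V by auto
      then show "(\<Sum>s<m. cnj (V (i + 1) $$ (s, a)) * V (i + 1) $$ (s, b)) =
          (mat_adjoint (V (Suc i)) * V (Suc i)) $$ (a, b)"
        using ab by (simp add: scalar_prod_def mat_adjoint_dim mat_adjoint_index lessThan_atLeast0)
    qed
    also have "\<dots> = (\<Sum>i=1..n. (mat_adjoint (V i) * V i) $$ (a, b))"
      by (rule sum.reindex_bij_witness[of _ "\<lambda>i. i - 1" Suc]) auto
    finally show ?thesis .
  qed
  have "isometry ?W \<longleftrightarrow> (\<forall>a<m. \<forall>b<m. (mat_adjoint ?W * ?W) $$ (a, b) = 1\<^sub>m m $$ (a, b))"
  proof
    assume "isometry ?W"
    then show "\<forall>a<m. \<forall>b<m. (mat_adjoint ?W * ?W) $$ (a, b) = 1\<^sub>m m $$ (a, b)"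
      by (simp only: isometry_def dim) simp
  next
    assume "\<forall>a<m. \<forall>b<m. (mat_adjoint ?W * ?W) $$ (a, b) = 1\<^sub>m m $$ (a, b)"
    then show "isometry ?W"
      unfolding isometry_def dim by (intro eq_matI) (simp_all add: dim mat_adjoint_dim)
  qed
  then show ?thesis using entry by simp
qed

lemma operator_system_carrier: "operator_system d (carrier_mat d d)"
  unfolding operator_system_def by (auto simp: mat_adjoint_dim)

lemma operator_system_block_toeplitz: "operator_system (n * m) (block_toeplitz n m)"
proof -
  define ok where "ok T \<longleftrightarrow>
    (\<forall>k. - (int n - 1) \<le> k \<and> k \<le> int n - 1 \<longrightarrow> T k \<in> carrier_mat m m)" for T :: "int \<Rightarrow> complex mat"
  define toep where "toep T = block_mat n m (\<lambda>i j. T (int i - int j))" for T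
  have BT: "block_toeplitz n m = {toep T | T. ok T}"
    by (simp add: block_toeplitz_def ok_def toep_def)
  have dim: "toep T \<in> carrier_mat (n * m) (n * m)" for T
    by (simp add: toep_def block_mat_def)
  have bound: "r div m < n" "r mod m < m" if "r < n * m" for r
  proof -
    show "r div m < n" using that by (simp add: less_mult_imp_div_less)
    have "0 < m" using that by (cases m) auto
    then show "r mod m < m" by simp
  qed
  have okD: "T (int (r div m) - int (c div m)) \<in> carrier_mat m m"
    if "ok T" "r < n * m" "c < n * m" for T r c
    using that bound[of r] bound[of c] unfolding ok_def by auto
  have ix: "toep T $$ (r, c) = T (int (r div m) - int (c div m)) $$ (r mod m, c mod m)"
    if "r < n * m" "c < n * m" for T r c
    using that by (simp add: toep_def block_mat_def)
  note dims = carrier_matD[OF dim] carrier_matD[OF okD]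
  have "1\<^sub>m (n * m) = toep (\<lambda>k. if k = 0 then 1\<^sub>m m else 0\<^sub>m m m)"
  proof (intro eq_matI)
    fix r c assume "r < dim_row (toep (\<lambda>k. if k = 0 then 1\<^sub>m m else 0\<^sub>m m m))"
      "c < dim_col (toep (\<lambda>k. if k = 0 then 1\<^sub>m m else 0\<^sub>m m m))"
    then have rc: "r < n * m" "c < n * m" by (simp_all add: dims)
    have "r = c \<longleftrightarrow> r div m = c div m \<and> r mod m = c mod m"
      by (metis div_mult_mod_eq)
    then show "1\<^sub>m (n * m) $$ (r, c) = toep (\<lambda>k. if k = 0 then 1\<^sub>m m else 0\<^sub>m m m) $$ (r, c)"
      using rc bound[OF rc(1)] bound[OF rc(2)] by (auto simp: ix)
  qed (simp_all add: dims)
  moreover have "ok (\<lambda>k. if k = 0 then 1\<^sub>m m else 0\<^sub>m m m)" by (simp add: ok_def)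
  ultimately have one: "1\<^sub>m (n * m) \<in> block_toeplitz n m" unfolding BT by blast
  have add: "toep T + toep U \<in> block_toeplitz n m" if "ok T" "ok U" for T U
  proof -
    have "toep T + toep U = toep (\<lambda>k. T k + U k)"
      using that bound by (intro eq_matI) (auto simp: dims ix)
    moreover have "ok (\<lambda>k. T k + U k)" using that by (simp add: ok_def)
    ultimately show ?thesis unfolding BT by blast
  qed
  have smult: "a \<cdot>\<^sub>m toep T \<in> block_toeplitz n m" if "ok T" for a T
  proof -
    have "a \<cdot>\<^sub>m toep T = toep (\<lambda>k. a \<cdot>\<^sub>m T k)"
      using that bound by (intro eq_matI) (auto simp: dims ix)
    moreover have "ok (\<lambda>k. a \<cdot>\<^sub>m T k)" using that by (simp add: ok_def)
    ultimately show ?thesis unfolding BT by blast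
  qed
  have adj: "mat_adjoint (toep T) \<in> block_toeplitz n m" if "ok T" for T
  proof -
    have "mat_adjoint (toep T) = toep (\<lambda>k. mat_adjoint (T (- k)))"
      using that bound by (intro eq_matI) (auto simp: dims ix mat_adjoint_dim mat_adjoint_index)
    moreover have "ok (\<lambda>k. mat_adjoint (T (- k)))"
      unfolding ok_def
    proof (intro allI impI)
      fix k assume "- (int n - 1) \<le> k \<and> k \<le> int n - 1"
      then have "T (- k) \<in> carrier_mat m m" using that unfolding ok_def by auto
      then show "mat_adjoint (T (- k)) \<in> carrier_mat m m"
        by (intro carrier_matI) (auto simp: mat_adjoint_dim)
    qed
    ultimately show ?thesis unfolding BT by blast
  qed
  show ?thesis
    unfolding operator_system_def using one add smult adj dim by (auto simp: BT)
qed

end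

theory Submission
  imports Defs
begin

text \<open>Every completely positive map from an operator system of matrices to matrices has the form
\<open>T \<mapsto> \<Sum>l. W l\<^sup>* T W l\<close> (Arveson's extension theorem combined with Choi's decomposition,
\<open>completely_positive_imp_kraus\<close>). For a block column \<open>W\<close>, the compression of the block Toeplitz matrix with
blocks \<open>z\<close> to the power \<open>i - j\<close> times \<open>A\<close>, where \<open>z\<close> lies on the unit circle, is \<open>Q\<^sub>W(z)\<^sup>* A Q\<^sub>W(z)\<close>. So a
map on the block Toeplitz system sees the matrix polynomials of its Kraus operators on the circle.

Suppose the operators \<open>W l\<close> and the single operator \<open>V\<close> give the same map on block Toeplitz matrices. Then
at each point of the circle the polynomial of every \<open>W l\<close> is a scalar multiple of \<open>Q\<^sub>V\<close>, with a factor of modulus at most one.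
The factor is a rational function of \<open>z\<close> whose poles are roots of \<open>Q\<^sub>V\<close>. If all these roots lie on the circle,
boundedness excludes poles, and if \<open>Q\<^sub>V\<close> has full degree \<open>n - 1\<close>, the factor is constant: every \<open>W l\<close> is a
multiple of \<open>V\<close> (\<open>kraus_rigidity\<close>). Joining Kraus decompositions of \<open>\<psi>\<close> and \<open>\<phi> - \<psi>\<close> shows that \<open>\<phi>\<close> is pure, and
a Kraus decomposition of any ucp extension of \<open>\<phi>\<close> shows that the extension is compression by \<open>V\<close>
(\<open>pure_of_roots_on_circle\<close>, \<open>unique_extension_of_roots_on_circle\<close>).

Conversely, purity collapses a Kraus decomposition to a single term \<open>V\<close> (\<open>pure_imp_kraus1\<close>). If \<open>Q\<^sub>V\<close> has a
root off the circle or too small a degree, then \<open>Q\<^sub>V\<close> is \<open>(\<beta> + \<alpha>z) R(z)\<close> with \<open>\<bar>\<alpha>\<bar> \<noteq> \<bar>\<beta>\<bar>\<close> and \<open>R\<close> of degree below \<open>n - 1\<close>.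
On the circle, \<open>\<bar>\<beta> + \<alpha>z\<bar>\<^sup>2\<close> is positive and a sum of two non-proportional squares \<open>\<bar>\<beta>' + \<alpha>'z\<bar>\<^sup>2\<close>, and this
decomposes \<open>\<phi>\<close> (\<open>not_pure_of_linear_factor\<close>). Finally, if \<open>\<phi>\<close> has a unique ucp extension and it is pure,
extensions of \<open>\<psi>\<close> and \<open>\<phi> - \<psi>\<close> add up to it, so \<open>\<phi>\<close> is pure as well.\<close>

section \<open>Extension of positive functionals\<close>

text \<open>A finite-dimensional M. Riesz extension argument: a functional on \<open>S\<close> that is nonnegative on the
cone \<open>P\<close> extends, positively, over the span of \<open>S\<close> and the vectors \<open>e c\<close>. Speaking of the combinations
\<open>h + (\<Sum>c. t c * e c)\<close> and not of a functional on the larger space avoids any question of whether such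
a representation is unique. One vector is adjoined at a time; the value \<open>\<gamma>\<close> assigned to it separates the lower
bounds \<open>A\<close> from the upper bounds \<open>B\<close> that positivity imposes, and the order units make both sets
nonempty.\<close>

lemma positive_functional_extension:
  fixes P S :: "('k \<Rightarrow> 'b::real_vector) set"
    and f :: "('k \<Rightarrow> 'b) \<Rightarrow> real" and e :: "'c \<Rightarrow> 'k \<Rightarrow> 'b"
  assumes J: "finite J"
    and P_add: "\<And>h k. h \<in> P \<Longrightarrow> k \<in> P \<Longrightarrow> (\<lambda>x. h x + k x) \<in> P"
    and P_scale: "\<And>r h. h \<in> P \<Longrightarrow> 0 \<le> r \<Longrightarrow> (\<lambda>x. r *\<^sub>R h x) \<in> P"
    and S_add: "\<And>h k. h \<in> S \<Longrightarrow> k \<in> S \<Longrightarrow> (\<lambda>x. h x + k x) \<in> S"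
    and S_scale: "\<And>r h. h \<in> S \<Longrightarrow> (\<lambda>x. r *\<^sub>R h x) \<in> S"
    and f_add: "\<And>h k. h \<in> S \<Longrightarrow> k \<in> S \<Longrightarrow> f (\<lambda>x. h x + k x) = f h + f k"
    and f_scale: "\<And>r h. h \<in> S \<Longrightarrow> f (\<lambda>x. r *\<^sub>R h x) = r * f h"
    and pos: "\<And>h. h \<in> S \<Longrightarrow> h \<in> P \<Longrightarrow> 0 \<le> f h"
    and order_unit: "\<And>c. c \<in> J \<Longrightarrow> \<exists>h\<in>S. (\<lambda>x. h x + e c x) \<in> P \<and> (\<lambda>x. h x - e c x) \<in> P"
  shows "\<exists>g. \<forall>h\<in>S. \<forall>t. (\<lambda>x. h x + (\<Sum>c\<in>J. t c *\<^sub>R e c x)) \<in> P \<longrightarrow>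
           0 \<le> f h + (\<Sum>c\<in>J. t c * g c)"
  using J order_unit
proof (induction J rule: finite_induct)
  case empty
  show ?case using pos by auto
next
  case (insert c J)
  from insert.IH[OF insert.prems[OF insertI2]] obtain g where
    g': "\<forall>h\<in>S. \<forall>t. (\<lambda>x. h x + (\<Sum>c\<in>J. t c *\<^sub>R e c x)) \<in> P \<longrightarrow>
      0 \<le> f h + (\<Sum>c\<in>J. t c * g c)" ..
  have g: "0 \<le> f h + (\<Sum>c\<in>J. t c * g c)"
    if "h \<in> S" "(\<lambda>x. h x + (\<Sum>c\<in>J. t c *\<^sub>R e c x)) \<in> P" for h t
    using that(2) bspec[OF g' that(1)] by (elim allE impE)
  obtain u where u: "u \<in> S" "(\<lambda>x. u x + e c x) \<in> P" "(\<lambda>x. u x - e c x) \<in> P"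
    using insert.prems by blast
  define A where "A = {- f h - (\<Sum>c\<in>J. t c * g c) | h t.
      h \<in> S \<and> (\<lambda>x. h x + (\<Sum>c\<in>J. t c *\<^sub>R e c x) + e c x) \<in> P}"
  define B where "B = {f h + (\<Sum>c\<in>J. t c * g c) | h t.
      h \<in> S \<and> (\<lambda>x. h x + (\<Sum>c\<in>J. t c *\<^sub>R e c x) - e c x) \<in> P}"
  have AB: "a \<le> b" if "a \<in> A" "b \<in> B" for a b
  proof -
    from that(1) obtain h t where h: "h \<in> S" "a = - f h - (\<Sum>c\<in>J. t c * g c)"
      "(\<lambda>x. h x + (\<Sum>c\<in>J. t c *\<^sub>R e c x) + e c x) \<in> P" unfolding A_def by auto
    from that(2) obtain h' t' where h': "h' \<in> S" "b = f h' + (\<Sum>c\<in>J. t' c * g c)"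
      "(\<lambda>x. h' x + (\<Sum>c\<in>J. t' c *\<^sub>R e c x) - e c x) \<in> P" unfolding B_def by auto
    have "(\<lambda>x. (h x + h' x) + (\<Sum>c\<in>J. (t c + t' c) *\<^sub>R e c x)) \<in> P"
      using P_add[OF h(3) h'(3)] by (simp add: scaleR_add_left sum.distrib algebra_simps)
    from g[OF S_add[OF h(1) h'(1)] this] show ?thesis
      using h h' by (simp add: f_add sum.distrib algebra_simps)
  qed
  have "- f u - (\<Sum>c\<in>J. 0 * g c) \<in> A" unfolding A_def
    by (rule CollectI, rule exI[of _ u], rule exI[of _ "\<lambda>_. 0"]) (use u in simp)
  then have A_ne: "A \<noteq> {}" by blast
  have "f u + (\<Sum>c\<in>J. 0 * g c) \<in> B" unfolding B_def
    by (rule CollectI, rule exI[of _ u], rule exI[of _ "\<lambda>_. 0"]) (use u in simp)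
  then obtain b0 where b0: "b0 \<in> B" by blast
  have bdd: "bdd_above A" using AB b0 by (meson bdd_aboveI)
  define \<gamma> where "\<gamma> = Sup A"
  have lo: "a \<le> \<gamma>" if "a \<in> A" for a unfolding \<gamma>_def by (rule cSup_upper[OF that bdd])
  have hi: "\<gamma> \<le> b" if "b \<in> B" for b unfolding \<gamma>_def by (rule cSup_least[OF A_ne]) (use AB that in auto)
  have "0 \<le> f h + (\<Sum>d\<in>insert c J. t d * (g(c := \<gamma>)) d)"
    if h: "h \<in> S" and hP: "(\<lambda>x. h x + (\<Sum>c\<in>insert c J. t c *\<^sub>R e c x)) \<in> P" for h t
  proof -
    have gJ: "(\<Sum>d\<in>J. t d * (g(c := \<gamma>)) d) = (\<Sum>d\<in>J. t d * g d)"
      by (rule sum.cong) (use insert.hyps in auto)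
    have hP': "(\<lambda>x. h x + t c *\<^sub>R e c x + (\<Sum>c\<in>J. t c *\<^sub>R e c x)) \<in> P"
      using hP insert.hyps by (simp add: add.assoc)
    consider "t c = 0" | "t c > 0" | "t c < 0" by linarith
    then have "0 \<le> f h + (\<Sum>d\<in>J. t d * g d) + t c * \<gamma>"
    proof cases
      case 1
      then show ?thesis using g[OF h, of t] hP' by simp
    next
      case 2
      define r where "r = inverse (t c)"
      have r: "0 < r" "r * t c = 1" using 2 by (auto simp: r_def)
      have "(\<lambda>x. r *\<^sub>R h x + (\<Sum>c\<in>J. (r * t c) *\<^sub>R e c x) + e c x) \<in> P"
        using P_scale[OF hP', of r] r by (simp add: scaleR_add_right scaleR_sum_right add_ac)
      then have "- f (\<lambda>x. r *\<^sub>R h x) - (\<Sum>c\<in>J. (r * t c) * g c) \<in> A"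
        unfolding A_def
        by (intro CollectI exI[of _ "\<lambda>x. r *\<^sub>R h x"] exI[of _ "\<lambda>c. r * t c"]) (simp add: S_scale[OF h])
      from lo[OF this] have "0 \<le> r * (f h + (\<Sum>d\<in>J. t d * g d)) + (r * t c) * \<gamma>"
        using h r by (simp add: f_scale sum_distrib_left algebra_simps)
      then have "0 \<le> r * (f h + (\<Sum>d\<in>J. t d * g d) + t c * \<gamma>)"
        by (simp add: algebra_simps)
      then show ?thesis using r by (simp add: zero_le_mult_iff)
    next
      case 3
      define r where "r = inverse (- t c)"
      have r: "0 < r" "r * t c = - 1" using 3 by (auto simp: r_def)
      have "(\<lambda>x. r *\<^sub>R h x + (\<Sum>c\<in>J. (r * t c) *\<^sub>R e c x) - e c x) \<in> P"
        using P_scale[OF hP', of r] r by (simp add: scaleR_add_right scaleR_sum_right algebra_simps)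
      then have "f (\<lambda>x. r *\<^sub>R h x) + (\<Sum>c\<in>J. (r * t c) * g c) \<in> B"
        unfolding B_def
        by (intro CollectI exI[of _ "\<lambda>x. r *\<^sub>R h x"] exI[of _ "\<lambda>c. r * t c"]) (simp add: S_scale[OF h])
      from hi[OF this] have "0 \<le> r * (f h + (\<Sum>d\<in>J. t d * g d)) + (r * t c) * \<gamma>"
        using h r by (simp add: f_scale sum_distrib_left algebra_simps)
      then have "0 \<le> r * (f h + (\<Sum>d\<in>J. t d * g d) + t c * \<gamma>)"
        by (simp add: algebra_simps)
      then show ?thesis using r by (simp add: zero_le_mult_iff)
    qed
    then show ?thesis using insert.hyps gJ by (simp add: algebra_simps)
  qed
  then show ?case by blast
qed

section \<open>Positive semidefinite kernels\<close>

definition sesq :: "'i set \<Rightarrow> ('i \<Rightarrow> 'i \<Rightarrow> complex) \<Rightarrow> ('i \<Rightarrow> complex) \<Rightarrow> complex" where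
  "sesq I K x = (\<Sum>i\<in>I. \<Sum>j\<in>I. cnj (x i) * K i j * x j)"

lemma sesq_insert:
  assumes "finite I" "p \<notin> I"
  shows "sesq (insert p I) K x = cnj (x p) * K p p * x p
    + cnj (x p) * (\<Sum>j\<in>I. K p j * x j) + (\<Sum>i\<in>I. cnj (x i) * K i p) * x p + sesq I K x"
  using assms by (simp add: sesq_def sum.distrib sum_distrib_left sum_distrib_right algebra_simps)

lemma sesq_cong:
  assumes "\<And>i j. i \<in> I \<Longrightarrow> j \<in> I \<Longrightarrow> K i j = K' i j" "\<And>i. i \<in> I \<Longrightarrow> x i = x' i"
  shows "sesq I K x = sesq I K' x'"
  unfolding sesq_def using assms by (intro sum.cong) auto

lemma sesq_support:
  assumes "finite I" "T \<subseteq> I" "\<And>i. i \<in> I - T \<Longrightarrow> x i = 0"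
  shows "sesq I K x = sesq T K x"
proof -
  have "sesq I K x = (\<Sum>i\<in>I. \<Sum>j\<in>T. cnj (x i) * K i j * x j)"
    unfolding sesq_def using assms by (intro sum.cong refl sum.mono_neutral_right) auto
  also have "\<dots> = sesq T K x"
    unfolding sesq_def using assms by (intro sum.mono_neutral_right) auto
  finally show ?thesis .
qed

lemma complex_nonneg_iff: "0 \<le> (z::complex) \<longleftrightarrow> 0 \<le> Re z \<and> Im z = 0"
  by (auto simp: less_eq_complex_def)

lemma hermitian_of_sesq_nonneg:
  assumes I: "finite I" "p \<in> I" "q \<in> I" and pos: "\<And>x. 0 \<le> sesq I K x"
  shows "K q p = cnj (K p q)" and "0 \<le> K p p"
proof -
  have dg: "0 \<le> K i i" if "i \<in> I" for i
  proof -
    have "sesq I K (\<lambda>j. if j = i then 1 else 0) = sesq {i} K (\<lambda>j. if j = i then 1 else 0)"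
      by (rule sesq_support) (use I that in auto)
    then show ?thesis using pos[of "\<lambda>j. if j = i then 1 else 0"] by (simp add: sesq_def)
  qed
  show "0 \<le> K p p" using dg I by blast
  show "K q p = cnj (K p q)"
  proof (cases "p = q")
    case True
    then show ?thesis using dg[of p] I by (simp add: complex_nonneg_iff complex_eq_iff)
  next
    case False
    have *: "Im (cnj s * K p q + K q p * s) = 0" for s
    proof -
      let ?x = "\<lambda>j. if j = p then s else if j = q then 1 else 0"
      have "sesq I K ?x = sesq {p, q} K ?x"
        by (rule sesq_support) (use I in auto)
      also have "\<dots> = cnj s * K p p * s + cnj s * K p q + K q p * s + K q q"
        using False by (simp add: sesq_def)
      finally have "0 = Im (cnj s * K p p * s + cnj s * K p q + K q p * s + K q q)"
        using pos[of ?x] by (simp add: complex_nonneg_iff)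
      moreover have "Im (cnj s * K p p * s) = 0" "Im (K q q) = 0"
        using dg[of p] dg[of q] I by (simp_all add: complex_nonneg_iff algebra_simps)
      ultimately show ?thesis by simp
    qed
    show ?thesis using *[of 1] *[of \<i>] by (simp add: complex_eq_iff)
  qed
qed

text \<open>Needed for the Schur complement below, where a vanishing pivot leaves nothing to divide by.\<close>

lemma psd_kernel_zero_row:
  assumes I: "finite I" "p \<in> I" "q \<in> I" and pos: "\<And>x. 0 \<le> sesq I K x" and "K p p = 0"
  shows "K p q = 0"
proof (rule ccontr)
  assume nz: "K p q \<noteq> 0"
  then have pq: "p \<noteq> q" using \<open>K p p = 0\<close> by auto
  have herm: "K q p = cnj (K p q)" by (rule hermitian_of_sesq_nonneg(1)[OF I pos])
  define N where "N = (cmod (K p q))\<^sup>2"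
  have N: "0 < N" "Re (K p q) * Re (K p q) + Im (K p q) * Im (K p q) = N"
    using nz by (simp add: N_def) (simp add: N_def cmod_power2 flip: power2_eq_square)
  \<comment> \<open>As \<open>K p p = 0\<close>, moving the entry at \<open>p\<close> changes the form at an affine rate;
    \<open>r\<close> is large enough to push it below zero.\<close>
  define r where "r = (Re (K q q) + 1) / N"
  define s where "s = - complex_of_real r * K p q"
  let ?x = "\<lambda>j. if j = p then s else if j = q then 1 else 0"
  have "sesq I K ?x = sesq {p, q} K ?x"
    by (rule sesq_support) (use I in auto)
  also have "\<dots> = cnj s * K p q + K q p * s + K q q"
    using pq \<open>K p p = 0\<close> by (simp add: sesq_def)
  finally have "0 \<le> Re (cnj s * K p q + K q p * s + K q q)"
    using pos[of ?x] by (simp add: complex_nonneg_iff)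
  also have "Re (cnj s * K p q + K q p * s + K q q)
      = Re (K q q) - 2 * r * (Re (K p q) * Re (K p q) + Im (K p q) * Im (K p q))"
    unfolding herm s_def by (simp add: algebra_simps)
  also have "\<dots> = Re (K q q) - 2 * (Re (K q q) + 1)"
    unfolding N(2) r_def using N(1) by simp
  finally have "0 \<le> Re (K q q) - 2 * (Re (K q q) + 1)" .
  moreover have "0 \<le> Re (K q q)"
    using hermitian_of_sesq_nonneg(2)[OF I(1) I(3) I(3) pos] by (simp add: complex_nonneg_iff)
  ultimately show False by simp
qed

text \<open>Cholesky elimination: subtracting from \<open>K\<close> the rank-one kernel built from the column of a pivot \<open>p\<close>
leaves the Schur complement \<open>K'\<close>, which is again positive because its form at \<open>x\<close> is the form of \<open>K\<close>
minimised over the entry at \<open>p\<close>. If the pivot is zero its whole row vanishes, and the convention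
\<open>z / 0 = 0\<close> makes the same formulas correct.\<close>

lemma psd_kernel_sum_rank_one:
  assumes "finite I" and "\<And>x. 0 \<le> sesq I K x"
  shows "\<exists>L (w :: nat \<Rightarrow> 'i \<Rightarrow> complex). \<forall>i\<in>I. \<forall>j\<in>I. K i j = (\<Sum>l<L. w l i * cnj (w l j))"
  using assms
proof (induction I arbitrary: K rule: finite_induct)
  case empty
  show ?case by simp
next
  case (insert p I)
  note fin = finite.insertI[OF insert.hyps(1), of p]
  have herm: "K j i = cnj (K i j)" if "i \<in> insert p I" "j \<in> insert p I" for i j
    by (rule hermitian_of_sesq_nonneg(1)[OF fin that insert.prems])
  define K' where "K' i j = K i j - K i p * K p j / K p p" for i j
  have K'pos: "0 \<le> sesq I K' x" for x
  proof -
    \<comment> \<open>\<open>x' p\<close> is the minimiser of the form of \<open>K\<close> over the entry at \<open>p\<close>.\<close>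
    define x' where "x' = x(p := - (\<Sum>j\<in>I. K p j * x j) / K p p)"
    have x'I: "x' i = x i" if "i \<in> I" for i using that insert.hyps by (auto simp: x'_def)
    define u where "u = (\<Sum>j\<in>I. K p j * x j)"
    have u': "(\<Sum>i\<in>I. cnj (x i) * K i p) = cnj u"
      unfolding u_def cnj_sum by (rule sum.cong[OF refl]) (subst herm[of p], auto)
    have x'p: "x' p = - u / K p p" by (simp add: x'_def u_def)
    have Kpp: "cnj (K p p) = K p p" using herm[of p p] by simp
    have "0 \<le> sesq (insert p I) K x'" by (rule insert.prems)
    also have "sesq (insert p I) K x' = cnj (x' p) * K p p * x' p
        + cnj (x' p) * u + cnj u * x' p + sesq I K x"
      unfolding sesq_insert[OF insert.hyps] using u'
      by (simp add: x'I u_def cong: sum.cong sesq_cong)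
    also have "\<dots> = sesq I K x - cnj u * u / K p p"
      unfolding x'p by (cases "K p p = 0") (simp_all add: Kpp field_simps)
    also have "cnj u * u / K p p = sesq I (\<lambda>i j. K i p * K p j / K p p) x"
      unfolding u'[symmetric] unfolding u_def sesq_def sum_product sum_divide_distrib
      by (intro sum.cong refl) simp
    also have "sesq I K x - sesq I (\<lambda>i j. K i p * K p j / K p p) x = sesq I K' x"
      by (simp add: sesq_def K'_def sum_subtractf[symmetric] algebra_simps)
    finally show ?thesis .
  qed
  from insert.IH[OF K'pos] obtain L :: nat and w
    where w': "\<forall>i\<in>I. \<forall>j\<in>I. K' i j = (\<Sum>l<L. w l i * cnj (w l j))"
    by (elim exE)
  define v where "v l i = (if l < L then (if i = p then 0 else w l i)
      else K i p / complex_of_real (sqrt (Re (K p p))))" for l i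
  have Kpp: "0 \<le> K p p"
    by (rule hermitian_of_sesq_nonneg(2)[OF fin _ _ insert.prems]) auto
  then have sq: "complex_of_real (sqrt (Re (K p p))) * complex_of_real (sqrt (Re (K p p))) = K p p"
    by (simp add: complex_nonneg_iff complex_eq_iff flip: of_real_mult)
  have zero: "K p i = 0" "K i p = 0" if "K p p = 0" "i \<in> insert p I" for i
  proof -
    show "K p i = 0" by (rule psd_kernel_zero_row[OF fin _ _ insert.prems]) (use that in auto)
    then show "K i p = 0" using herm[of p i] that by simp
  qed
  have "K i j = (\<Sum>l<Suc L. v l i * cnj (v l j))" if ij: "i \<in> insert p I" "j \<in> insert p I" for i j
  proof -
    have last: "v L i * cnj (v L j) = K i p * K p j / K p p"
      using ij sq by (simp add: v_def herm[of p j] flip: of_real_mult)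
    have "(\<Sum>l<L. v l i * cnj (v l j)) = (if i = p \<or> j = p then 0 else K' i j)"
      using ij w' by (auto simp: v_def)
    then have "(\<Sum>l<Suc L. v l i * cnj (v l j))
        = (if i = p \<or> j = p then 0 else K' i j) + K i p * K p j / K p p"
      using last by simp
    also have "\<dots> = K i j"
      using zero[of i] zero[of j] ij by (cases "K p p = 0") (auto simp: K'_def)
    finally show ?thesis by simp
  qed
  then show ?case by blast
qed

section \<open>Positive functionals on spaces of kernels\<close>

definition kernel_adj :: "('i \<times> 'i \<Rightarrow> complex) \<Rightarrow> 'i \<times> 'i \<Rightarrow> complex" where
  "kernel_adj K = (\<lambda>(i, j). cnj (K (j, i)))"

definition kernel_one :: "'i \<times> 'i \<Rightarrow> complex" where
  "kernel_one = (\<lambda>(i, j). if i = j then 1 else 0)"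

abbreviation sesqu :: "'i set \<Rightarrow> ('i \<times> 'i \<Rightarrow> complex) \<Rightarrow> ('i \<Rightarrow> complex) \<Rightarrow> complex" where
  "sesqu I K \<equiv> sesq I (curry K)"

lemma sesqu_add: "sesqu I (\<lambda>c. K c + K' c) x = sesqu I K x + sesqu I K' x"
  by (simp add: sesq_def sum.distrib algebra_simps)

lemma sesqu_diff: "sesqu I (\<lambda>c. K c - K' c) x = sesqu I K x - sesqu I K' x"
  by (simp add: sesq_def sum_subtractf algebra_simps)

lemma sesqu_scale: "sesqu I (\<lambda>c. z * K c) x = z * sesqu I K x"
  by (simp add: sesq_def sum_distrib_left algebra_simps)

lemma sesqu_adj: "sesqu I (kernel_adj K) x = cnj (sesqu I K x)"
  unfolding sesq_def by (subst sum.swap) (simp add: kernel_adj_def algebra_simps)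

lemma sesqu_one:
  assumes "finite I"
  shows "sesqu I kernel_one x = of_real (\<Sum>i\<in>I. (cmod (x i))\<^sup>2)"
proof -
  have "sesqu I kernel_one x = (\<Sum>i\<in>I. \<Sum>j\<in>I. if i = j then cnj (x i) * x j else 0)"
    unfolding sesq_def by (intro sum.cong refl) (simp add: kernel_one_def)
  also have "\<dots> = of_real (\<Sum>i\<in>I. (cmod (x i))\<^sup>2)"
    using assms by (simp add: mult.commute flip: complex_norm_square)
  finally show ?thesis .
qed

lemma mult_le_sum_squares:
  assumes "finite I" "i \<in> I" "j \<in> I"
  shows "cmod (x i) * cmod (x j) \<le> (\<Sum>i\<in>I. (cmod (x i))\<^sup>2)"
proof -
  have le: "(cmod (x k))\<^sup>2 \<le> (\<Sum>i\<in>I. (cmod (x i))\<^sup>2)" if "k \<in> I" for k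
    using assms that by (intro member_le_sum) auto
  have "2 * (cmod (x i) * cmod (x j)) \<le> (cmod (x i))\<^sup>2 + (cmod (x j))\<^sup>2"
    using sum_squares_bound[of "cmod (x i)" "cmod (x j)"] by simp
  then show ?thesis using le[OF assms(2)] le[OF assms(3)] by linarith
qed

lemma sesqu_bound:
  assumes "finite I"
  shows "cmod (sesqu I K x) \<le> (\<Sum>i\<in>I. \<Sum>j\<in>I. cmod (K (i, j))) * (\<Sum>i\<in>I. (cmod (x i))\<^sup>2)"
proof -
  have "cmod (sesqu I K x) \<le> (\<Sum>i\<in>I. \<Sum>j\<in>I. cmod (cnj (x i) * K (i, j) * x j))"
    unfolding sesq_def curry_def by (intro order_trans[OF norm_sum] sum_mono) simp
  also have "\<dots> = (\<Sum>i\<in>I. \<Sum>j\<in>I. cmod (K (i, j)) * (cmod (x i) * cmod (x j)))"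
    by (simp add: norm_mult algebra_simps)
  also have "\<dots> \<le> (\<Sum>i\<in>I. \<Sum>j\<in>I. cmod (K (i, j)) * (\<Sum>i\<in>I. (cmod (x i))\<^sup>2))"
    by (intro sum_mono mult_left_mono mult_le_sum_squares assms) auto
  also have "\<dots> = (\<Sum>i\<in>I. \<Sum>j\<in>I. cmod (K (i, j))) * (\<Sum>i\<in>I. (cmod (x i))\<^sup>2)"
    by (simp add: sum_distrib_right)
  finally show ?thesis .
qed

text \<open>Every positive functional on a self-adjoint space \<open>S\<close> of kernels containing the identity is the pairing
with a positive kernel \<open>D\<close>. The extension lemma is applied to \<open>Re \<circ> F\<close> and to the cone of kernels whose
form has nonnegative real part, which contains all anti-Hermitian kernels. So the coordinates
\<open>Re (K (i, j))\<close> and \<open>Im (K (i, j))\<close> of arbitrary kernels can be used, without a basis of the Hermitian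
ones, and nonnegativity of the extension on this cone also forces the form of \<open>D\<close> to be real.\<close>

lemma positive_functional_representation:
  fixes S :: "('i \<times> 'i \<Rightarrow> complex) set" and F :: "('i \<times> 'i \<Rightarrow> complex) \<Rightarrow> complex"
  assumes I: "finite I"
    and S_add: "\<And>H K. H \<in> S \<Longrightarrow> K \<in> S \<Longrightarrow> (\<lambda>c. H c + K c) \<in> S"
    and S_scale: "\<And>z K. K \<in> S \<Longrightarrow> (\<lambda>c. z * K c) \<in> S"
    and S_adj: "\<And>K. K \<in> S \<Longrightarrow> kernel_adj K \<in> S"
    and S_one: "kernel_one \<in> S"
    and F_add: "\<And>H K. H \<in> S \<Longrightarrow> K \<in> S \<Longrightarrow> F (\<lambda>c. H c + K c) = F H + F K"
    and F_scale: "\<And>z K. K \<in> S \<Longrightarrow> F (\<lambda>c. z * K c) = z * F K"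
    and F_pos: "\<And>K. K \<in> S \<Longrightarrow> (\<And>x. 0 \<le> sesqu I K x) \<Longrightarrow> 0 \<le> F K"
  shows "\<exists>D. (\<forall>x. 0 \<le> sesq I D x) \<and> (\<forall>K\<in>S. F K = (\<Sum>i\<in>I. \<Sum>j\<in>I. K (i, j) * D i j))"
proof -
  have real_F: "Im (F H) = 0" if H: "H \<in> S" "kernel_adj H = H" for H
  proof -
    \<comment> \<open>Adding \<open>b\<close> times the identity makes \<open>H\<close> positive.\<close>
    define b where "b = (\<Sum>i\<in>I. \<Sum>j\<in>I. cmod (H (i, j)))"
    have one': "(\<lambda>c. of_real b * kernel_one c) \<in> S" by (rule S_scale[OF S_one])
    have "0 \<le> F (\<lambda>c. H c + of_real b * kernel_one c)"
    proof (rule F_pos)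
      show "(\<lambda>c. H c + of_real b * kernel_one c) \<in> S" by (rule S_add[OF H(1) one'])
      fix x
      have "cnj (sesqu I H x) = sesqu I H x" using sesqu_adj[of I H x] H(2) by simp
      then have "Im (sesqu I H x) = 0" by (simp add: complex_eq_iff)
      moreover have "- Re (sesqu I H x) \<le> b * (\<Sum>i\<in>I. (cmod (x i))\<^sup>2)"
        using sesqu_bound[OF I, of H x] abs_Re_le_cmod[of "sesqu I H x"] unfolding b_def by linarith
      ultimately show "0 \<le> sesqu I (\<lambda>c. H c + of_real b * kernel_one c) x"
        unfolding sesqu_add sesqu_scale sesqu_one[OF I] complex_nonneg_iff by simp
    qed
    also have "\<dots> = F H + of_real b * F kernel_one"
      by (simp add: F_add[OF H(1) one'] F_scale[OF S_one])
    finally have "Im (F H) + b * Im (F kernel_one) = 0" by (simp add: complex_nonneg_iff)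
    moreover have "0 \<le> F kernel_one"
      by (rule F_pos[OF S_one]) (simp add: sesqu_one[OF I] complex_nonneg_iff sum_nonneg)
    ultimately show ?thesis by (simp add: complex_nonneg_iff)
  qed
  have Re_F_adj: "Re (F (kernel_adj K)) = Re (F K)" if K: "K \<in> S" for K
  proof -
    \<comment> \<open>\<open>\<i> * (K - kernel_adj K)\<close> is Hermitian.\<close>
    define N where "N c = \<i> * (K c + (- 1) * kernel_adj K c)" for c
    have m: "(\<lambda>c. (- 1) * kernel_adj K c) \<in> S" by (rule S_scale[OF S_adj[OF K]])
    have "N \<in> S" unfolding N_def by (rule S_scale[OF S_add[OF K m]])
    moreover have "kernel_adj N = N"
      by (rule ext) (simp add: N_def kernel_adj_def algebra_simps split: prod.split)
    ultimately have "Im (F N) = 0" by (rule real_F)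
    moreover have "F N = \<i> * (F K + (- 1) * F (kernel_adj K))"
      unfolding N_def by (simp only: F_scale[OF S_add[OF K m]] F_add[OF K m] F_scale[OF S_adj[OF K]])
    ultimately show ?thesis by simp
  qed
  define P where "P = {K. \<forall>x. 0 \<le> Re (sesqu I K x)}"
  define J where "J = I \<times> I \<times> {1, \<i>}"
  define e :: "'i \<times> 'i \<times> complex \<Rightarrow> 'i \<times> 'i \<Rightarrow> complex"
    where "e = (\<lambda>(i, j, z) (i', j'). if i' = i \<and> j' = j then z else (0::complex))"
  have "\<exists>g. \<forall>h\<in>S. \<forall>t. (\<lambda>c. h c + (\<Sum>b\<in>J. t b *\<^sub>R e b c)) \<in> P \<longrightarrow>
           0 \<le> (\<lambda>K. Re (F K)) h + (\<Sum>b\<in>J. t b * g b)"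
  proof (rule positive_functional_extension)
    show "finite J" using I by (simp add: J_def)
    show "(\<lambda>c. h c + k c) \<in> P" if "h \<in> P" "k \<in> P" for h k
      using that by (simp add: P_def sesqu_add)
    show "(\<lambda>c. r *\<^sub>R h c) \<in> P" if "h \<in> P" "0 \<le> r" for h r
      using that by (simp add: P_def scaleR_conv_of_real sesqu_scale)
    show "(\<lambda>c. h c + k c) \<in> S" if "h \<in> S" "k \<in> S" for h k using that by (rule S_add)
    show "(\<lambda>c. r *\<^sub>R h c) \<in> S" if "h \<in> S" for h r
      unfolding scaleR_conv_of_real using that by (rule S_scale)
    show "Re (F (\<lambda>c. h c + k c)) = Re (F h) + Re (F k)" if "h \<in> S" "k \<in> S" for h k
      using F_add[OF that] by simp
    show "Re (F (\<lambda>c. r *\<^sub>R h c)) = r * Re (F h)" if "h \<in> S" for h r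
      unfolding scaleR_conv_of_real using F_scale[OF that, of "of_real r"] by simp
    show "0 \<le> Re (F h)" if h: "h \<in> S" "h \<in> P" for h
    proof -
      have "0 \<le> F (\<lambda>c. h c + kernel_adj h c)"
      proof (rule F_pos)
        show "(\<lambda>c. h c + kernel_adj h c) \<in> S" by (rule S_add[OF h(1) S_adj[OF h(1)]])
        show "0 \<le> sesqu I (\<lambda>c. h c + kernel_adj h c) x" for x
          using h(2) unfolding sesqu_add sesqu_adj P_def complex_nonneg_iff by simp
      qed
      then show ?thesis
        using F_add[OF h(1) S_adj[OF h(1)]] Re_F_adj[OF h(1)] by (simp add: complex_nonneg_iff)
    qed
    show "\<exists>h\<in>S. (\<lambda>c. h c + e b c) \<in> P \<and> (\<lambda>c. h c - e b c) \<in> P" if b: "b \<in> J" for b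
    proof (rule bexI[OF _ S_one])
      from b obtain i j z where ijz: "b = (i, j, z)" "i \<in> I" "j \<in> I" "cmod z = 1"
        unfolding J_def by auto
      have "\<bar>Re (sesqu I (e b) x)\<bar> \<le> (\<Sum>i\<in>I. (cmod (x i))\<^sup>2)" for x
      proof -
        have "sesqu I (e b) x
            = (\<Sum>i'\<in>I. if i' = i then \<Sum>j'\<in>I. if j' = j then cnj (x i') * z * x j' else 0 else 0)"
          unfolding sesq_def by (intro sum.cong refl) (auto simp: e_def ijz(1) intro!: sum.cong)
        also have "\<dots> = cnj (x i) * z * x j" using I ijz by simp
        finally have "cmod (sesqu I (e b) x) = cmod (x i) * cmod (x j)"
          using ijz(4) by (simp add: norm_mult)
        then show ?thesis
          using mult_le_sum_squares[OF I ijz(2,3), of x] abs_Re_le_cmod[of "sesqu I (e b) x"] by linarith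
      qed
      then show "(\<lambda>c. kernel_one c + e b c) \<in> P \<and> (\<lambda>c. kernel_one c - e b c) \<in> P"
        unfolding P_def mem_Collect_eq sesqu_add sesqu_diff sesqu_one[OF I] abs_le_iff by (auto simp: algebra_simps)
          (metis add.commute add.right_inverse add_left_mono)
    qed
  qed
  then obtain g where g': "\<forall>h\<in>S. \<forall>t. (\<lambda>c. h c + (\<Sum>b\<in>J. t b *\<^sub>R e b c)) \<in> P \<longrightarrow>
           0 \<le> Re (F h) + (\<Sum>b\<in>J. t b * g b)" by blast
  define D where "D i j = Complex (g (i, j, 1)) (- g (i, j, \<i>))" for i j
  define pair where "pair K = (\<Sum>i\<in>I. \<Sum>j\<in>I. K (i, j) * D i j)" for K
  have pair_scale: "pair (\<lambda>c. z * K c) = z * pair K" for z K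
    by (simp add: pair_def sum_distrib_left algebra_simps)
  have g: "0 \<le> Re (F h) + Re (pair K)"
    if h: "h \<in> S" and hK: "\<And>x. 0 \<le> Re (sesqu I (\<lambda>c. h c + K c) x)" for h K
  proof -
    define t :: "'i \<times> 'i \<times> complex \<Rightarrow> real" where
      "t = (\<lambda>(i, j, z). if z = 1 then Re (K (i, j)) else Im (K (i, j)))"
    have sumJ: "(\<Sum>b\<in>J. u b) = (\<Sum>i\<in>I. \<Sum>j\<in>I. u (i, j, 1) + u (i, j, \<i>))"
      for u :: "_ \<Rightarrow> 'z :: comm_monoid_add"
      unfolding J_def by (simp add: sum.cartesian_product')
    have "(\<Sum>b\<in>J. t b *\<^sub>R e b (i, j)) = K (i, j)" if ij: "i \<in> I" "j \<in> I" for i j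
    proof -
      have "(\<Sum>b\<in>J. t b *\<^sub>R e b (i, j))
          = (\<Sum>i'\<in>I. if i' = i then \<Sum>j'\<in>I. if j' = j then K (i', j') else 0 else 0)"
        unfolding sumJ
        by (intro sum.cong refl)
           (auto simp: t_def e_def complex_eq_iff intro!: sum.cong sum.neutral)
      also have "\<dots> = K (i, j)" using I ij by simp
      finally show ?thesis .
    qed
    then have "sesqu I (\<lambda>c. h c + (\<Sum>b\<in>J. t b *\<^sub>R e b c)) x = sesqu I (\<lambda>c. h c + K c) x" for x
      by (intro sesq_cong) auto
    then have "(\<lambda>c. h c + (\<Sum>b\<in>J. t b *\<^sub>R e b c)) \<in> P"
      using hK by (simp add: P_def)
    then have "0 \<le> Re (F h) + (\<Sum>b\<in>J. t b * g b)"
      using bspec[OF g' h] by (elim allE impE)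
    also have "(\<Sum>b\<in>J. t b * g b) = Re (pair K)"
      unfolding sumJ pair_def by (simp add: t_def D_def complex_eq_iff)
    finally show ?thesis .
  qed
  have zero: "(\<lambda>c. 0) \<in> S" and F_zero: "F (\<lambda>c. 0) = 0"
    using S_scale[OF S_one, of 0] F_scale[OF S_one, of 0] by simp_all
  have Re_rep: "Re (F K) = Re (pair K)" if K: "K \<in> S" for K
  proof -
    have "0 \<le> Re (F K) + Re (pair (\<lambda>c. (- 1) * K c))"
      by (rule g[OF K]) (simp add: sesq_def)
    moreover have "0 \<le> Re (F (\<lambda>c. (- 1) * K c)) + Re (pair K)"
      by (rule g[OF S_scale[OF K]]) (simp add: sesq_def)
    ultimately show ?thesis unfolding pair_scale F_scale[OF K] by simp
  qed
  have rep: "F K = pair K" if K: "K \<in> S" for K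
    using Re_rep[OF K] Re_rep[OF S_scale[OF K, of "- \<i>"]]
    unfolding pair_scale F_scale[OF K] by (simp add: complex_eq_iff)
  have "0 \<le> sesq I D x" for x
  proof -
    \<comment> \<open>The pairing of \<open>D\<close> with this rank-one kernel is the form of \<open>D\<close> at \<open>x\<close>; the multiples of the
      kernel by \<open>\<i>\<close> and \<open>- \<i>\<close> have purely imaginary form, which settles the imaginary part.\<close>
    define K where "K = (\<lambda>(i, j). cnj (x i) * x j)"
    have D: "sesq I D x = pair K"
      unfolding sesq_def pair_def by (intro sum.cong refl) (simp add: K_def)
    have sK: "sesqu I K y = of_real ((cmod (\<Sum>i\<in>I. x i * y i))\<^sup>2)" for y
    proof -
      have "sesqu I K y = cnj (\<Sum>i\<in>I. x i * y i) * (\<Sum>i\<in>I. x i * y i)"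
        unfolding sesq_def cnj_sum sum_product by (intro sum.cong refl) (simp add: K_def)
      then show ?thesis unfolding complex_norm_square by (simp only: mult.commute)
    qed
    have "0 \<le> Re (pair (\<lambda>c. z * K c))" if "Re z \<ge> 0" for z
      using g[OF zero, of "\<lambda>c. z * K c"] that by (simp add: F_zero sesqu_scale sK)
    from this[of 1] this[of \<i>] this[of "- \<i>"] show ?thesis
      unfolding D pair_scale complex_nonneg_iff by simp
  qed
  then show ?thesis using rep unfolding pair_def by blast
qed

section \<open>Kraus maps and complete positivity\<close>

lemma sum_blocks:
  fixes F :: "nat \<Rightarrow> complex"
  assumes "0 < d"
  shows "(\<Sum>r<k * d. F r) = (\<Sum>i\<in>{..<k} \<times> {..<d}. F (fst i * d + snd i))"
  using sum_div_mod[OF assms, of "\<lambda>p a. F (p * d + a)" k]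
  by (simp add: sum.cartesian_product')

definition block_kernel :: "(nat \<Rightarrow> nat \<Rightarrow> complex mat) \<Rightarrow> nat \<times> nat \<Rightarrow> nat \<times> nat \<Rightarrow> complex" where
  "block_kernel X = (\<lambda>(p, a) (q, b). X p q $$ (a, b))"

lemma block_index_less:
  assumes "p < k" "a < d"
  shows "p * d + a < k * (d::nat)"
proof -
  have "p * d + a < Suc p * d" using assms by simp
  also have "\<dots> \<le> k * d" using assms by (intro mult_le_mono1) auto
  finally show ?thesis .
qed

lemma block_mat_sesq:
  assumes d: "0 < d" and v: "v \<in> carrier_vec (k * d)"
  shows "(block_mat k d X *\<^sub>v v) \<bullet>c v
    = sesq ({..<k} \<times> {..<d}) (block_kernel X) (\<lambda>(p, a). v $ (p * d + a))"
proof -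
  have "(block_mat k d X *\<^sub>v v) \<bullet>c v
      = (\<Sum>r<k * d. \<Sum>c<k * d. cnj (v $ r) * X (r div d) (c div d) $$ (r mod d, c mod d) * v $ c)"
    using v by (simp add: scalar_prod_def block_mat_def sum_distrib_left sum_distrib_right
        lessThan_atLeast0 algebra_simps)
  also have "\<dots> = sesq ({..<k} \<times> {..<d}) (block_kernel X) (\<lambda>(p, a). v $ (p * d + a))"
    unfolding sesq_def sum_blocks[OF d]
    by (intro sum.cong refl) (auto simp: block_kernel_def split: prod.splits)
  finally show ?thesis .
qed

lemma psd_block_mat_iff:
  assumes d: "0 < d"
  shows "psd (k * d) (block_mat k d X)
    \<longleftrightarrow> (\<forall>x. 0 \<le> sesq ({..<k} \<times> {..<d}) (block_kernel X) x)"
proof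
  assume psd: "psd (k * d) (block_mat k d X)"
  show "\<forall>x. 0 \<le> sesq ({..<k} \<times> {..<d}) (block_kernel X) x"
  proof
    fix x :: "nat \<times> nat \<Rightarrow> complex"
    define v where "v = vec (k * d) (\<lambda>r. x (r div d, r mod d))"
    have v: "v \<in> carrier_vec (k * d)" by (simp add: v_def)
    have "0 \<le> (block_mat k d X *\<^sub>v v) \<bullet>c v" using psd v unfolding psd_def by blast
    also have "\<dots> = sesq ({..<k} \<times> {..<d}) (block_kernel X) x"
      unfolding block_mat_sesq[OF d v]
      by (intro sesq_cong) (auto simp: v_def block_index_less)
    finally show "0 \<le> sesq ({..<k} \<times> {..<d}) (block_kernel X) x" .
  qed
next
  assume "\<forall>x. 0 \<le> sesq ({..<k} \<times> {..<d}) (block_kernel X) x"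
  then show "psd (k * d) (block_mat k d X)"
    unfolding psd_def by (auto simp: block_mat_sesq[OF d]) (simp_all add: block_mat_def)
qed

text \<open>The map with Kraus operators \<open>W 0, \<dots>, W (L - 1)\<close>, where \<open>W l r x\<close> is the entry in row \<open>r\<close> and column \<open>x\<close>
of the \<open>d \<times> m\<close> matrix of the \<open>l\<close>-th one.\<close>

definition kraus :: "nat \<Rightarrow> nat \<Rightarrow> nat \<Rightarrow> (nat \<Rightarrow> nat \<Rightarrow> nat \<Rightarrow> complex) \<Rightarrow> complex mat \<Rightarrow> complex mat" where
  "kraus d m L W X = mat m m (\<lambda>(x, y). \<Sum>l<L. \<Sum>a<d. \<Sum>b<d. cnj (W l a x) * X $$ (a, b) * W l b y)"

lemma kraus_carrier [simp]: "kraus d m L W X \<in> carrier_mat m m"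
  by (simp add: kraus_def)

lemma kraus_index:
  assumes "x < m" "y < m"
  shows "kraus d m L W X $$ (x, y) = (\<Sum>l<L. \<Sum>a<d. \<Sum>b<d. cnj (W l a x) * X $$ (a, b) * W l b y)"
  using assms by (simp add: kraus_def)

lemma kraus_add:
  assumes "X \<in> carrier_mat d d" "Y \<in> carrier_mat d d"
  shows "kraus d m L W (X + Y) = kraus d m L W X + kraus d m L W Y"
proof (rule eq_matI)
  fix x y
  assume "x < dim_row (kraus d m L W X + kraus d m L W Y)" "y < dim_col (kraus d m L W X + kraus d m L W Y)"
  then have xy: "x < m" "y < m" by (simp_all add: kraus_def)
  have "kraus d m L W (X + Y) $$ (x, y) = (\<Sum>l<L. \<Sum>a<d. \<Sum>b<d.
      cnj (W l a x) * X $$ (a, b) * W l b y + cnj (W l a x) * Y $$ (a, b) * W l b y)"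
    unfolding kraus_index[OF xy] using assms by (intro sum.cong refl) (simp add: algebra_simps)
  also have "\<dots> = kraus d m L W X $$ (x, y) + kraus d m L W Y $$ (x, y)"
    unfolding kraus_index[OF xy] sum.distrib ..
  finally show "kraus d m L W (X + Y) $$ (x, y) = (kraus d m L W X + kraus d m L W Y) $$ (x, y)"
    using xy by (simp add: kraus_def)
qed (simp_all add: kraus_def)

lemma kraus_smult:
  assumes "X \<in> carrier_mat d d"
  shows "kraus d m L W (z \<cdot>\<^sub>m X) = z \<cdot>\<^sub>m kraus d m L W X"
proof (rule eq_matI)
  fix x y
  assume "x < dim_row (z \<cdot>\<^sub>m kraus d m L W X)" "y < dim_col (z \<cdot>\<^sub>m kraus d m L W X)"
  then have xy: "x < m" "y < m" by (simp_all add: kraus_def)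
  have "kraus d m L W (z \<cdot>\<^sub>m X) $$ (x, y) = z * kraus d m L W X $$ (x, y)"
    unfolding kraus_index[OF xy] sum_distrib_left using assms by (intro sum.cong refl) simp
  then show "kraus d m L W (z \<cdot>\<^sub>m X) $$ (x, y) = (z \<cdot>\<^sub>m kraus d m L W X) $$ (x, y)"
    using xy by (simp add: kraus_def)
qed (simp_all add: kraus_def)

text \<open>The form of the image block matrix at \<open>v\<close> is the sum over \<open>l\<close> of the form of the original block matrix
at \<open>u l\<close>, the vector obtained by applying the \<open>l\<close>-th Kraus operator to each block of \<open>v\<close>.\<close>

lemma completely_positive_kraus:
  assumes S: "operator_system d S" and dm: "0 < d" "0 < m"
    and \<phi>: "\<And>X. X \<in> S \<Longrightarrow> \<phi> X = kraus d m L W X"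
  shows "completely_positive d S m \<phi>"
  unfolding completely_positive_def linear_map_on_def
proof (intro conjI ballI allI impI)
  have SC: "X \<in> carrier_mat d d" if "X \<in> S" for X using S that unfolding operator_system_def by blast
  show "\<phi> X \<in> carrier_mat m m" if "X \<in> S" for X using \<phi>[OF that] by simp
  show "\<phi> (X + Y) = \<phi> X + \<phi> Y" if "X \<in> S" "Y \<in> S" for X Y
  proof -
    have "X + Y \<in> S" using S that unfolding operator_system_def by blast
    then show ?thesis using \<phi> that by (simp add: kraus_add SC)
  qed
  show "\<phi> (z \<cdot>\<^sub>m X) = z \<cdot>\<^sub>m \<phi> X" if "X \<in> S" for X z
  proof -
    have "z \<cdot>\<^sub>m X \<in> S" using S that unfolding operator_system_def by blast
    then show ?thesis using \<phi> that by (simp add: kraus_smult SC)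
  qed
  fix k and X :: "nat \<Rightarrow> nat \<Rightarrow> complex mat"
  assume X: "\<forall>i<k. \<forall>j<k. X i j \<in> S" and psd: "psd (k * d) (block_mat k d X)"
  show "psd (k * m) (block_mat k m (\<lambda>i j. \<phi> (X i j)))"
    unfolding psd_block_mat_iff[OF dm(2)]
  proof
    fix v :: "nat \<times> nat \<Rightarrow> complex"
    define u where "u l = (\<lambda>(p, a). \<Sum>x<m. W l a x * v (p, x))" for l
    have entry: "block_kernel (\<lambda>i j. \<phi> (X i j)) (p, x) (q, y)
        = (\<Sum>l<L. \<Sum>a<d. \<Sum>b<d. cnj (W l a x) * X p q $$ (a, b) * W l b y)"
      if "p < k" "q < k" "x < m" "y < m" for p q x y
      using \<phi>[of "X p q"] X that by (simp add: block_kernel_def kraus_index)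
    have "sesq ({..<k} \<times> {..<m}) (block_kernel (\<lambda>i j. \<phi> (X i j))) v
        = (\<Sum>p<k. \<Sum>x<m. \<Sum>q<k. \<Sum>y<m. \<Sum>l<L. \<Sum>a<d. \<Sum>b<d.
            cnj (v (p, x)) * (cnj (W l a x) * X p q $$ (a, b) * W l b y) * v (q, y))"
      unfolding sesq_def sum.cartesian_product'
      by (intro sum.cong refl) (simp add: entry sum_distrib_left sum_distrib_right)
    also have "\<dots> = (\<Sum>l<L. \<Sum>p<k. \<Sum>a<d. \<Sum>q<k. \<Sum>b<d. \<Sum>x<m. \<Sum>y<m.
            cnj (v (p, x)) * (cnj (W l a x) * X p q $$ (a, b) * W l b y) * v (q, y))"
    proof -
      have push: "(\<Sum>x<m. \<Sum>q<k. \<Sum>y<m. \<Sum>l<L. \<Sum>a<d. \<Sum>b<d. f x q y l a b)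
        = (\<Sum>l<L. \<Sum>a<d. \<Sum>q<k. \<Sum>b<d. \<Sum>x<m. \<Sum>y<m. f x q y l a b)"
        for f :: "_ \<Rightarrow> _ \<Rightarrow> _ \<Rightarrow> _ \<Rightarrow> _ \<Rightarrow> _ \<Rightarrow> complex"
        unfolding sum.cartesian_product
        by (rule sum.reindex_bij_witness[of _ "\<lambda>(l, a, q, b, x, y). (x, q, y, l, a, b)"
              "\<lambda>(x, q, y, l, a, b). (l, a, q, b, x, y)"]) auto
      show ?thesis unfolding push by (rule sum.swap)
    qed
    also have "\<dots> = (\<Sum>l<L. sesq ({..<k} \<times> {..<d}) (block_kernel X) (u l))"
      unfolding sesq_def sum.cartesian_product'
      by (intro sum.cong refl)
         (simp add: u_def block_kernel_def sum_distrib_left sum_distrib_right algebra_simps)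
    also have "0 \<le> \<dots>"
      using psd unfolding psd_block_mat_iff[OF dm(1)] by (intro sum_nonneg) blast
    finally show "0 \<le> sesq ({..<k} \<times> {..<m}) (block_kernel (\<lambda>i j. \<phi> (X i j))) v" .
  qed
qed

text \<open>Arveson's extension theorem and Choi's decomposition in one step. The map \<open>\<phi>\<close> corresponds to the
functional \<open>F\<close> on \<open>m \<times> m\<close> block matrices over \<open>S\<close> that adds the entries \<open>(p, q)\<close> of \<open>\<phi>\<close> of the block \<open>(p, q)\<close>.
Complete positivity makes \<open>F\<close> positive, so \<open>F\<close> is the pairing with a positive kernel, and a splitting of
this kernel into rank-one kernels gives the Kraus operators.\<close>

theorem completely_positive_imp_kraus:
  assumes S: "operator_system d S" and cp: "completely_positive d S m \<phi>" and dm: "0 < d" "0 < m"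
  shows "\<exists>L W. \<forall>X\<in>S. \<phi> X = kraus d m L W X"
proof -
  have SC: "X \<in> carrier_mat d d" if "X \<in> S" for X using S that unfolding operator_system_def by blast
  have S1: "1\<^sub>m d \<in> S" and Sadd: "\<And>X Y. X \<in> S \<Longrightarrow> Y \<in> S \<Longrightarrow> X + Y \<in> S"
    and Ssm: "\<And>z X. X \<in> S \<Longrightarrow> z \<cdot>\<^sub>m X \<in> S" and Sadj: "\<And>X. X \<in> S \<Longrightarrow> mat_adjoint X \<in> S"
    using S unfolding operator_system_def by blast+
  have S0: "0\<^sub>m d d \<in> S"
  proof -
    have "0\<^sub>m d d = (0::complex) \<cdot>\<^sub>m 1\<^sub>m d" by (intro eq_matI) auto
    then show ?thesis using Ssm[OF S1] by metis
  qed
  have \<phi>C: "\<phi> X \<in> carrier_mat m m" and \<phi>add: "Y \<in> S \<Longrightarrow> \<phi> (X + Y) = \<phi> X + \<phi> Y"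
    and \<phi>sm: "\<phi> (z \<cdot>\<^sub>m X) = z \<cdot>\<^sub>m \<phi> X" if "X \<in> S" for X Y z
    using cp that unfolding completely_positive_def linear_map_on_def by blast+
  have \<phi>0: "\<phi> (0\<^sub>m d d) = 0\<^sub>m m m"
  proof -
    have "\<phi> (0\<^sub>m d d) = \<phi> ((0::complex) \<cdot>\<^sub>m 0\<^sub>m d d)"
      by (rule arg_cong[of _ _ \<phi>]) (intro eq_matI, auto)
    also have "\<dots> = 0 \<cdot>\<^sub>m \<phi> (0\<^sub>m d d)" by (rule \<phi>sm[OF S0])
    also have "\<dots> = 0\<^sub>m m m" using \<phi>C[OF S0] by (intro eq_matI) auto
    finally show ?thesis .
  qed
  define I where "I = {..<m} \<times> {..<d}"
  define blk where "blk K p q = mat d d (\<lambda>(a, b). K ((p, a), (q, b)))"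
    for K :: "(nat \<times> nat) \<times> (nat \<times> nat) \<Rightarrow> complex" and p q
  define S' where "S' = {K. \<forall>p<m. \<forall>q<m. blk K p q \<in> S}"
  define F where "F K = (\<Sum>p<m. \<Sum>q<m. \<phi> (blk K p q) $$ (p, q))" for K
  have S'D: "blk K p q \<in> S" if "K \<in> S'" "p < m" "q < m" for K p q
    using that unfolding S'_def by blast
  have blk_add: "blk (\<lambda>c. H c + K c) p q = blk H p q + blk K p q" for H K p q
    by (intro eq_matI) (auto simp: blk_def)
  have blk_scale: "blk (\<lambda>c. z * K c) p q = z \<cdot>\<^sub>m blk K p q" for z K p q
    by (intro eq_matI) (auto simp: blk_def)
  have blk_adj: "blk (kernel_adj K) p q = mat_adjoint (blk K q p)" for K p q
    by (intro eq_matI) (auto simp: blk_def kernel_adj_def mat_adjoint_dim mat_adjoint_index)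
  have blk_one: "blk kernel_one p q = (if p = q then 1\<^sub>m d else 0\<^sub>m d d)" for p q
    by (intro eq_matI) (auto simp: blk_def kernel_one_def)
  have "\<exists>D. (\<forall>x. 0 \<le> sesq I D x) \<and> (\<forall>K\<in>S'. F K = (\<Sum>i\<in>I. \<Sum>j\<in>I. K (i, j) * D i j))"
  proof (rule positive_functional_representation)
    show "finite I" by (simp add: I_def)
    show "(\<lambda>c. H c + K c) \<in> S'" if "H \<in> S'" "K \<in> S'" for H K
      using that Sadd unfolding S'_def by (simp add: blk_add)
    show "(\<lambda>c. z * K c) \<in> S'" if "K \<in> S'" for z K
      using that Ssm unfolding S'_def by (simp add: blk_scale)
    show "kernel_adj K \<in> S'" if "K \<in> S'" for K
      using that Sadj unfolding S'_def by (simp add: blk_adj)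
    show "kernel_one \<in> S'" using S1 S0 unfolding S'_def by (simp add: blk_one)
    show "F (\<lambda>c. H c + K c) = F H + F K" if HK: "H \<in> S'" "K \<in> S'" for H K
    proof -
      have "\<phi> (blk H p q + blk K p q) $$ (p, q) = \<phi> (blk H p q) $$ (p, q) + \<phi> (blk K p q) $$ (p, q)"
        if "p < m" "q < m" for p q
        using \<phi>add[OF S'D[OF HK(1) that] S'D[OF HK(2) that]] \<phi>C[OF S'D[OF HK(2) that]] that
          by simp
      then show ?thesis unfolding F_def blk_add sum.distrib[symmetric] by (intro sum.cong refl) simp
    qed
    show "F (\<lambda>c. z * K c) = z * F K" if K: "K \<in> S'" for z K
    proof -
      have "\<phi> (z \<cdot>\<^sub>m blk K p q) $$ (p, q) = z * \<phi> (blk K p q) $$ (p, q)"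
        if "p < m" "q < m" for p q
        using \<phi>sm[OF S'D[OF K that]] \<phi>C[OF S'D[OF K that]] that by simp
      then show ?thesis unfolding F_def blk_scale sum_distrib_left by (intro sum.cong refl) simp
    qed
    show "0 \<le> F K" if K: "K \<in> S'" and pos: "\<And>x. 0 \<le> sesqu I K x" for K
    proof -
      have "psd (m * d) (block_mat m d (blk K))"
        unfolding psd_block_mat_iff[OF dm(1)]
      proof
        fix x
        have "sesq ({..<m} \<times> {..<d}) (block_kernel (blk K)) x = sesqu I K x"
          unfolding I_def by (intro sesq_cong) (auto simp: block_kernel_def blk_def)
        then show "0 \<le> sesq ({..<m} \<times> {..<d}) (block_kernel (blk K)) x" using pos by simp
      qed
      then have "psd (m * m) (block_mat m m (\<lambda>p q. \<phi> (blk K p q)))"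
        using cp S'D[OF K] unfolding completely_positive_def by blast
      \<comment> \<open>Evaluated at the vector \<open>\<Sum>p. e p \<otimes> e p\<close>, the form is \<open>F K\<close>.\<close>
      then have "0 \<le> sesq ({..<m} \<times> {..<m}) (block_kernel (\<lambda>p q. \<phi> (blk K p q)))
          (\<lambda>(p, a). if a = p then 1 else 0)"
        unfolding psd_block_mat_iff[OF dm(2)] by blast
      also have "\<dots> = (\<Sum>p<m. \<Sum>a<m. if a = p then \<Sum>q<m. \<Sum>b<m. if b = q then
          \<phi> (blk K p q) $$ (a, b) else 0 else 0)"
        unfolding sesq_def sum.cartesian_product'
        by (intro sum.cong refl) (auto simp: block_kernel_def if_distrib[of "(*) _"] cong: if_cong intro!: sum.cong)
      also have "\<dots> = F K" unfolding F_def by simp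
      finally show ?thesis .
    qed
  qed
  then obtain D where D: "\<And>x. 0 \<le> sesq I D x"
    and FD: "\<And>K. K \<in> S' \<Longrightarrow> F K = (\<Sum>i\<in>I. \<Sum>j\<in>I. K (i, j) * D i j)" by blast
  have "finite I" by (simp add: I_def)
  from psd_kernel_sum_rank_one[OF this D] obtain L :: nat and w
    where w: "\<forall>i\<in>I. \<forall>j\<in>I. D i j = (\<Sum>l<L. w l i * cnj (w l j))" by (elim exE)
  define W where "W l a p = cnj (w l (p, a))" for l and a p :: nat
  have "\<phi> X = kraus d m L W X" if X: "X \<in> S" for X
  proof (rule eq_matI)
    fix p q assume "p < dim_row (kraus d m L W X)" "q < dim_col (kraus d m L W X)"
    then have pq: "p < m" "q < m" by (simp_all add: kraus_def)
    define K where "K = (\<lambda>((p', a), (q', b)). if p' = p \<and> q' = q then X $$ (a, b) else 0)"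
    have blk: "blk K p' q' = (if p' = p \<and> q' = q then X else 0\<^sub>m d d)" for p' q'
      using SC[OF X] by (intro eq_matI) (auto simp: blk_def K_def)
    have "K \<in> S'" using X S0 unfolding S'_def by (simp add: blk)
    have "\<phi> X $$ (p, q) = (\<Sum>p'<m. if p' = p then \<Sum>q'<m. if q' = q then \<phi> X $$ (p, q) else 0 else 0)"
      using pq by simp
    also have "\<dots> = (\<Sum>p'<m. \<Sum>q'<m. if p' = p \<and> q' = q then \<phi> X $$ (p, q) else 0)"
      by (intro sum.cong refl) auto
    also have "\<dots> = F K"
      unfolding F_def blk by (intro sum.cong refl) (auto simp: \<phi>0)
    also have "\<dots> = (\<Sum>i\<in>I. \<Sum>j\<in>I. K (i, j) * D i j)" by (rule FD) fact
    also have "\<dots> = (\<Sum>p'<m. \<Sum>a<d. \<Sum>q'<m. if q' = q then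
        \<Sum>b<d. if p' = p then X $$ (a, b) * D (p, a) (q, b) else 0 else 0)"
      unfolding I_def sum.cartesian_product' by (intro sum.cong refl) (auto simp: K_def intro!: sum.cong)
    also have "\<dots> = (\<Sum>p'<m. \<Sum>a<d. \<Sum>b<d. if p' = p then X $$ (a, b) * D (p, a) (q, b) else 0)"
      using pq by simp
    also have "\<dots> = (\<Sum>p'<m. if p' = p then \<Sum>a<d. \<Sum>b<d. X $$ (a, b) * D (p, a) (q, b) else 0)"
      by (intro sum.cong refl) auto
    also have "\<dots> = (\<Sum>a<d. \<Sum>b<d. X $$ (a, b) * D (p, a) (q, b))" using pq by simp
    also have "\<dots> = (\<Sum>a<d. \<Sum>b<d. \<Sum>l<L. cnj (W l a p) * X $$ (a, b) * W l b q)"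
      using w pq by (intro sum.cong refl) (simp add: I_def W_def sum_distrib_left algebra_simps)
    also have "\<dots> = (\<Sum>a<d. \<Sum>l<L. \<Sum>b<d. cnj (W l a p) * X $$ (a, b) * W l b q)"
      by (intro sum.cong refl sum.swap)
    also have "\<dots> = kraus d m L W X $$ (p, q)"
      unfolding kraus_index[OF pq] by (rule sum.swap)
    finally show "\<phi> X $$ (p, q) = kraus d m L W X $$ (p, q)" .
  qed (use \<phi>C[OF X] in \<open>simp_all add: kraus_def\<close>)
  then show ?thesis by blast
qed

section \<open>Polynomial families on the unit circle\<close>

text \<open>No point of the unit circle is isolated in it, so an inequality between continuous functions survives
at finitely many exceptional points.\<close>

lemma circle_le_cofinite:
  fixes f g :: "complex \<Rightarrow> real"
  assumes cont: "isCont f z" "isCont g z" and F: "finite F"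
    and le: "\<And>w. cmod w = 1 \<Longrightarrow> w \<notin> F \<Longrightarrow> f w \<le> g w" and z: "cmod z = 1"
  shows "f z \<le> g z"
proof -
  let ?p = "\<lambda>t::real. z * cis t"
  have p: "(?p \<longlongrightarrow> z) (at_right 0)"
  proof -
    have "(?p \<longlongrightarrow> z * cis 0) (at_right 0)"
      by (intro tendsto_intros)
    then show ?thesis by simp
  qed
  have "eventually (\<lambda>t. ?p t \<noteq> w) (at_right 0)" for w
  proof (cases "w = z")
    case True
    have "eventually (\<lambda>t::real. 0 < t \<and> t < pi) (at_right 0)"
      using eventually_at_right_real[of 0 pi] by (auto elim: eventually_mono)
    then show ?thesis
    proof (rule eventually_mono)
      fix t :: real assume "0 < t \<and> t < pi"
      then have "0 < Im (cis t)" by (simp add: sin_gt_zero)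
      then have "cis t \<noteq> 1" by (auto simp del: cis.sel)
      then show "?p t \<noteq> w" using True z by auto
    qed
  next
    case False
    then show ?thesis using tendsto_imp_eventually_ne[OF p] by metis
  qed
  then have "eventually (\<lambda>t. \<forall>w\<in>F. ?p t \<noteq> w) (at_right 0)"
    by (intro eventually_ball_finite[OF F]) auto
  then have "eventually (\<lambda>t. f (?p t) \<le> g (?p t)) (at_right 0)"
    by (rule eventually_mono) (auto intro!: le simp: norm_mult z)
  then show ?thesis
    using isCont_tendsto_compose[OF cont(1) p] isCont_tendsto_compose[OF cont(2) p]
    by (intro tendsto_le[of "at_right (0::real)" "\<lambda>t. g (?p t)" "g z" "\<lambda>t. f (?p t)" "f z"]) auto
qed

lemma infinite_circle: "infinite {z. cmod z = 1}"
proof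
  assume "finite {z. cmod z = 1}"
  then have "(1::real) \<le> 0"
    by (rule circle_le_cofinite[where f = "\<lambda>_. 1" and g = "\<lambda>_. 0" and z = 1, rotated 2]) auto
  then show False by simp
qed

lemma poly_eq_on_circle:
  fixes p q :: "complex poly"
  assumes "\<And>z. cmod z = 1 \<Longrightarrow> poly p z = poly q z"
  shows "p = q"
proof (rule ccontr)
  assume "p \<noteq> q"
  then have "finite {z. poly (p - q) z = 0}" by (intro poly_roots_finite) simp
  moreover have "{z. cmod z = 1} \<subseteq> {z. poly (p - q) z = 0}" using assms by auto
  ultimately show False using infinite_circle finite_subset by blast
qed

text \<open>The rational function \<open>u / w\<close> is the common ratio of all \<open>s y\<close> and \<open>q y\<close>. A pole \<open>a\<close> that does not cancel
would be a common root of all \<open>q y\<close>, hence a point of the circle; but there \<open>u / w\<close> is bounded. So every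
root of \<open>w\<close> can be cancelled against one of \<open>u\<close>, by induction on the degree.\<close>

lemma dvd_of_circle_bound:
  fixes q s :: "'x \<Rightarrow> complex poly"
  assumes roots: "\<And>a. (\<And>y. y \<in> Y \<Longrightarrow> poly (q y) a = 0) \<Longrightarrow> cmod a = 1"
  shows "(\<And>y. y \<in> Y \<Longrightarrow> s y * w = u * q y) \<Longrightarrow>
    (\<And>z. cmod z = 1 \<Longrightarrow> cmod (poly u z) \<le> cmod (poly w z)) \<Longrightarrow> w \<noteq> 0 \<Longrightarrow> w dvd u"
proof (induction "degree w" arbitrary: u w)
  case 0
  then show ?case by (metis degree_eq_zeroE is_unit_pCons_iff pCons_0_0 unit_imp_dvd)
next
  case (Suc d)
  have "\<not> constant (poly w)" using Suc.hyps(2) by (simp add: constant_degree)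
  then obtain a where a: "poly w a = 0" using fundamental_theorem_of_algebra by blast
  have ua: "poly u a = 0"
  proof (rule ccontr)
    assume nz: "poly u a \<noteq> 0"
    have "poly (q y) a = 0" if "y \<in> Y" for y
      using arg_cong[OF Suc.prems(1)[OF that], of "\<lambda>p. poly p a"] a nz by simp
    then have "cmod a = 1" by (rule roots)
    then show False using Suc.prems(2)[of a] a nz by simp
  qed
  from a obtain w' where w': "w = [:- a, 1:] * w'" by (auto simp: poly_eq_0_iff_dvd)
  from ua obtain u' where u': "u = [:- a, 1:] * u'" by (auto simp: poly_eq_0_iff_dvd)
  have w'0: "w' \<noteq> 0" using w' Suc.prems(3) by auto
  have "w' dvd u'"
  proof (rule Suc.hyps(1))
    have "degree w = 1 + degree w'" unfolding w' using w'0 by (subst degree_mult_eq) auto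
    then show "d = degree w'" using Suc.hyps(2) by simp
    show "s y * w' = u' * q y" if "y \<in> Y" for y
    proof -
      have "[:- a, 1:] * (s y * w') = [:- a, 1:] * (u' * q y)"
        using Suc.prems(1)[OF that] unfolding w' u' by (simp only: mult_ac)
      then show ?thesis by (subst (asm) mult_cancel_left) auto
    qed
    show "cmod (poly u' z) \<le> cmod (poly w' z)" if z: "cmod z = 1" for z
    proof (rule circle_le_cofinite[OF _ _ _ _ z, where F = "{a}"])
      show "cmod (poly u' w) \<le> cmod (poly w' w)" if "cmod w = 1" "w \<notin> {a}" for w
        using Suc.prems(2)[OF that(1)] that(2) unfolding w' u'
        by (simp add: norm_mult flip: left_diff_distrib)
    qed (auto intro!: continuous_intros)
    show "w' \<noteq> 0" by fact
  qed
  then show ?case unfolding w' u' by (rule mult_dvd_mono[OF dvd_refl])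
qed

text \<open>The ratio of the two families is a polynomial by the previous lemma; at the index \<open>x0\<close> the degree
condition makes it a constant.\<close>

lemma proportional_poly_family:
  fixes q s :: "'x \<Rightarrow> complex poly"
  assumes roots: "\<And>a. (\<And>y. y \<in> Y \<Longrightarrow> poly (q y) a = 0) \<Longrightarrow> cmod a = 1"
    and minors: "\<And>x y. x \<in> Y \<Longrightarrow> y \<in> Y \<Longrightarrow> s x * q y = s y * q x"
    and bound: "\<And>x z. x \<in> Y \<Longrightarrow> cmod z = 1 \<Longrightarrow> cmod (poly (s x) z) \<le> cmod (poly (q x) z)"
    and x0: "x0 \<in> Y" "q x0 \<noteq> 0" "degree (s x0) \<le> degree (q x0)"
  shows "\<exists>c. \<forall>y\<in>Y. s y = smult c (q y)"
proof -
  have "q x0 dvd s x0"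
    by (rule dvd_of_circle_bound[of Y q s, OF roots]) (use minors bound x0 in auto)
  then obtain k where k: "s x0 = q x0 * k" by (rule dvdE)
  have "degree k = 0"
  proof (cases "k = 0")
    case False
    then have "degree (s x0) = degree (q x0) + degree k" unfolding k using x0 by (intro degree_mult_eq) auto
    then show ?thesis using x0(3) by simp
  qed simp
  then obtain c where c: "k = [:c:]" by (rule degree_eq_zeroE)
  have "s y = smult c (q y)" if "y \<in> Y" for y
  proof -
    have "q x0 * s y = q x0 * smult c (q y)"
      using minors[OF that x0(1)] unfolding k c by (simp add: mult_ac)
    then show ?thesis using x0(2) by (simp only: mult_cancel_left simp_thms)
  qed
  then show ?thesis by blast
qed

text \<open>If the vectors \<open>s l\<close> have the Gram matrix of the single vector \<open>q\<close>, each of them is a multiple of \<open>q\<close> by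
a factor of modulus at most one. The first claim says this through vanishing \<open>2 \<times> 2\<close> minors: the sum of
their squared moduli expands into the Gram identities.\<close>

lemma rank_one_gram:
  fixes s :: "nat \<Rightarrow> 'x \<Rightarrow> complex" and q :: "'x \<Rightarrow> complex"
  assumes gram: "\<And>x y. x \<in> Y \<Longrightarrow> y \<in> Y \<Longrightarrow> (\<Sum>l<L. cnj (s l x) * s l y) = cnj (q x) * q y"
    and l: "l < L" and xy: "x \<in> Y" "y \<in> Y"
  shows "s l x * q y = s l y * q x" and "cmod (s l x) \<le> cmod (q x)"
proof -
  have "complex_of_real (\<Sum>l<L. (cmod (s l x * q y - s l y * q x))\<^sup>2)
      = (\<Sum>l<L. cnj (s l x * q y - s l y * q x) * (s l x * q y - s l y * q x))"
    unfolding of_real_sum complex_norm_square by (intro sum.cong refl) (rule mult.commute)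
  also have "\<dots> = (\<Sum>l<L. cnj (s l x) * s l x * (cnj (q y) * q y)) - (\<Sum>l<L. cnj (s l x) * s l y * (cnj (q y) * q x))
      - (\<Sum>l<L. cnj (s l y) * s l x * (cnj (q x) * q y)) + (\<Sum>l<L. cnj (s l y) * s l y * (cnj (q x) * q x))"
    by (simp add: sum_subtractf[symmetric] sum.distrib[symmetric] algebra_simps)
  also have "\<dots> = 0"
    unfolding sum_distrib_right[symmetric] gram[OF xy(1) xy(1)] gram[OF xy] gram[OF xy(2) xy(1)] gram[OF xy(2) xy(2)]
    by simp
  finally have "(\<Sum>l<L. (cmod (s l x * q y - s l y * q x))\<^sup>2) = 0" unfolding of_real_eq_0_iff .
  then have "(cmod (s l x * q y - s l y * q x))\<^sup>2 = 0"
    using l by (subst (asm) sum_nonneg_eq_0_iff) auto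
  then show "s l x * q y = s l y * q x" by simp
  have "complex_of_real (\<Sum>l<L. (cmod (s l x))\<^sup>2) = (\<Sum>l<L. cnj (s l x) * s l x)"
    unfolding of_real_sum complex_norm_square by (intro sum.cong refl) (rule mult.commute)
  also have "\<dots> = of_real ((cmod (q x))\<^sup>2)"
    unfolding gram[OF xy(1) xy(1)] complex_norm_square by (rule mult.commute)
  finally have "(\<Sum>l<L. (cmod (s l x))\<^sup>2) = (cmod (q x))\<^sup>2" unfolding of_real_eq_iff .
  moreover have "(cmod (s l x))\<^sup>2 \<le> (\<Sum>l<L. (cmod (s l x))\<^sup>2)"
    using l by (intro member_le_sum) auto
  ultimately show "cmod (s l x) \<le> cmod (q x)" by (simp add: power2_le_iff_abs_le)
qed

section \<open>Compressions of block Toeplitz matrices\<close>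

text \<open>The block Toeplitz matrix with blocks \<open>z\<close> to the power \<open>i - j\<close> times the matrix unit \<open>(\<alpha>, \<beta>)\<close>, for \<open>z\<close> on
the unit circle.\<close>

definition toeplitz_test :: "nat \<Rightarrow> nat \<Rightarrow> complex \<Rightarrow> nat \<Rightarrow> nat \<Rightarrow> complex mat" where
  "toeplitz_test n m z \<alpha> \<beta> = mat (n * m) (n * m)
     (\<lambda>(r, c). if r mod m = \<alpha> \<and> c mod m = \<beta> then z ^ (r div m) * cnj z ^ (c div m) else 0)"

lemma circle_cnj_mult: "cmod z = 1 \<Longrightarrow> z * cnj z = 1"
  by (simp flip: complex_norm_square)

lemma circle_power_diff:
  assumes "cmod z = 1"
  shows "z ^ i * cnj z ^ j = (if j \<le> i then z ^ (i - j) else cnj z ^ (j - i))"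
proof -
  have c: "z ^ k * cnj z ^ k = 1" for k
    using circle_cnj_mult[OF assms] by (simp flip: power_mult_distrib)
  show ?thesis
  proof (cases "j \<le> i")
    case True
    then have "z ^ i = z ^ (i - j) * z ^ j" by (simp flip: power_add)
    then show ?thesis using True c[of j] by (simp add: mult.assoc)
  next
    case False
    then have "cnj z ^ j = cnj z ^ i * cnj z ^ (j - i)" by (simp flip: power_add)
    then have "z ^ i * cnj z ^ j = (z ^ i * cnj z ^ i) * cnj z ^ (j - i)" by (simp only: mult.assoc)
    then show ?thesis using False c[of i] by simp
  qed
qed

lemma toeplitz_test_in:
  assumes "cmod z = 1" "0 < m"
  shows "toeplitz_test n m z \<alpha> \<beta> \<in> block_toeplitz n m"
proof -
  define T where "T k = mat m m (\<lambda>(a, b). if a = \<alpha> \<and> b = \<beta>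
      then if 0 \<le> k then z ^ nat k else cnj z ^ nat (- k) else 0)" for k :: int
  have nat_diff: "nat (int i - int j) = i - j" for i j :: nat by simp
  have "toeplitz_test n m z \<alpha> \<beta> = block_mat n m (\<lambda>i j. T (int i - int j))"
    using assms(2) by (intro eq_matI)
      (auto simp: toeplitz_test_def block_mat_def T_def nat_diff circle_power_diff[OF assms(1)])
  moreover have "T k \<in> carrier_mat m m" for k by (simp add: T_def)
  ultimately show ?thesis unfolding block_toeplitz_def by blast
qed

text \<open>The entries of the matrix polynomial of a block column, the first block being the leading coefficient:
the entry \<open>(a, x)\<close> of \<open>Q\<^sub>V\<close> if \<open>V r x\<close> is the entry \<open>(r, x)\<close> of the column.\<close>

definition col_poly :: "nat \<Rightarrow> nat \<Rightarrow> (nat \<Rightarrow> nat \<Rightarrow> complex) \<Rightarrow> nat \<times> nat \<Rightarrow> complex poly" where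
  "col_poly n m V = (\<lambda>(a, x). \<Sum>j<n. monom (V (j * m + a) x) (n - 1 - j))"

lemma coeff_col_poly:
  "coeff (col_poly n m V (a, x)) k = (if k < n then V ((n - 1 - k) * m + a) x else 0)"
proof -
  have "coeff (col_poly n m V (a, x)) k = (\<Sum>j<n. if n - 1 - j = k then V (j * m + a) x else 0)"
    by (simp add: col_poly_def coeff_sum)
  also have "\<dots> = (\<Sum>j<n. if j = n - 1 - k then if k < n then V (j * m + a) x else 0 else 0)"
    by (intro sum.cong refl) auto
  also have "\<dots> = (if k < n then V ((n - 1 - k) * m + a) x else 0)" by auto
  finally show ?thesis .
qed

lemma degree_col_poly: "degree (col_poly n m V (a, x)) \<le> n - 1"
  by (rule degree_le) (auto simp: coeff_col_poly)

text \<open>Compressing the test matrix for \<open>A\<close> at \<open>z\<close> by a column \<open>V\<close> gives \<open>Q\<^sub>V(z)\<^sup>* A Q\<^sub>V(z)\<close>: a map on the block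
Toeplitz matrices determines its matrix polynomials on the circle up to the ambiguity of Kraus
decompositions. The exponent \<open>n - 1 - i\<close> replaces \<open>- i\<close>, which is harmless where \<open>z * cnj z = 1\<close>.\<close>

lemma kraus_toeplitz_test:
  assumes z: "cmod z = 1" and xy: "x < m" "y < m" and ab: "\<alpha> < m" "\<beta> < m"
  shows "kraus (n * m) m L W (toeplitz_test n m z \<alpha> \<beta>) $$ (x, y)
    = (\<Sum>l<L. cnj (poly (col_poly n m (W l) (\<alpha>, x)) z) * poly (col_poly n m (W l) (\<beta>, y)) z)"
proof -
  have m: "0 < m" using xy by simp
  have pw: "z ^ i * cnj z ^ j = cnj (z ^ (n - 1 - i)) * z ^ (n - 1 - j)" if "i < n" "j < n" for i j
    using circle_power_diff[OF z, of i j] circle_power_diff[OF z, of "n - 1 - j" "n - 1 - i"] that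
    by (auto simp: mult.commute)
  show ?thesis
    unfolding kraus_index[OF xy]
  proof (intro sum.cong refl)
    fix l
    have "(\<Sum>r<n * m. \<Sum>c<n * m. cnj (W l r x) * toeplitz_test n m z \<alpha> \<beta> $$ (r, c) * W l c y)
      = (\<Sum>i<n. \<Sum>a<m. \<Sum>j<n. \<Sum>b<m. if a = \<alpha> \<and> b = \<beta> then
          cnj (W l (i * m + \<alpha>) x) * (z ^ i * cnj z ^ j) * W l (j * m + \<beta>) y else 0)"
      unfolding sum_blocks[OF m] sum.cartesian_product'
      by (intro sum.cong refl) (auto simp: toeplitz_test_def block_index_less)
    also have "\<dots> = (\<Sum>i<n. \<Sum>a<m. \<Sum>j<n. if a = \<alpha> then
          cnj (W l (i * m + \<alpha>) x) * (z ^ i * cnj z ^ j) * W l (j * m + \<beta>) y else 0)"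
      using ab by (intro sum.cong refl) auto
    also have "\<dots> = (\<Sum>i<n. \<Sum>a<m. if a = \<alpha> then
          \<Sum>j<n. cnj (W l (i * m + \<alpha>) x) * (z ^ i * cnj z ^ j) * W l (j * m + \<beta>) y else 0)"
      by (intro sum.cong refl) auto
    also have "\<dots> = (\<Sum>i<n. \<Sum>j<n. cnj (W l (i * m + \<alpha>) x) * (z ^ i * cnj z ^ j) * W l (j * m + \<beta>) y)"
      using ab by simp
    also have "\<dots> = (\<Sum>i<n. \<Sum>j<n. cnj (W l (i * m + \<alpha>) x * z ^ (n - 1 - i)) * (W l (j * m + \<beta>) y * z ^ (n - 1 - j)))"
      by (intro sum.cong refl) (simp add: pw)
    also have "\<dots> = cnj (poly (col_poly n m (W l) (\<alpha>, x)) z) * poly (col_poly n m (W l) (\<beta>, y)) z"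
      unfolding sum_product[symmetric] by (simp add: col_poly_def poly_sum poly_monom)
    finally show "(\<Sum>r<n * m. \<Sum>c<n * m. cnj (W l r x) * toeplitz_test n m z \<alpha> \<beta> $$ (r, c) * W l c y)
      = cnj (poly (col_poly n m (W l) (\<alpha>, x)) z) * poly (col_poly n m (W l) (\<beta>, y)) z" .
  qed
qed

lemma col_poly_eqD:
  assumes eq: "\<And>y. y \<in> {..<m} \<times> {..<m} \<Longrightarrow> col_poly n m W y = smult c (col_poly n m V y)"
    and r: "r < n * m" "x < m"
  shows "W r x = c * V r x"
proof -
  have m: "0 < m" using r by simp
  have i: "r div m < n" using r by (simp add: less_mult_imp_div_less)
  have "coeff (col_poly n m W (r mod m, x)) (n - 1 - r div m)
      = c * coeff (col_poly n m V (r mod m, x)) (n - 1 - r div m)"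
    using eq[of "(r mod m, x)"] r m by simp
  then show ?thesis using i by (simp add: coeff_col_poly)
qed

text \<open>At every point of the circle the entries of the polynomials of the \<open>W l\<close> have
the Gram matrix of those of \<open>V\<close>, so the polynomials are proportional there, with a ratio bounded by one.
The common roots of the entries of \<open>Q\<^sub>V\<close> lie on the circle and \<open>Q\<^sub>V\<close> has full degree (the first block
of \<open>V\<close> is nonzero), so the ratio is a constant.\<close>

theorem kraus_rigidity:
  assumes n: "0 < n"
    and eq: "\<And>T. T \<in> block_toeplitz n m \<Longrightarrow> kraus (n * m) m L W T = kraus (n * m) m 1 (\<lambda>_. V) T"
    and top: "a0 < m" "x0 < m" "V a0 x0 \<noteq> 0"
    and roots: "\<And>z. (\<And>a x. a < m \<Longrightarrow> x < m \<Longrightarrow> poly (col_poly n m V (a, x)) z = 0) \<Longrightarrow> cmod z = 1"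
    and l: "l < L"
  shows "\<exists>c. \<forall>r<n * m. \<forall>x<m. W l r x = c * V r x"
proof -
  have m: "0 < m" using top by simp
  define Y where "Y = {..<m} \<times> {..<m}"
  have gram: "(\<Sum>l<L. cnj (poly (col_poly n m (W l) p) z) * poly (col_poly n m (W l) p') z)
      = cnj (poly (col_poly n m V p) z) * poly (col_poly n m V p') z"
    if z: "cmod z = 1" and "p \<in> Y" "p' \<in> Y" for p p' z
  proof -
    from that obtain \<alpha> x \<beta> y where p: "p = (\<alpha>, x)" "p' = (\<beta>, y)" "x < m" "y < m" "\<alpha> < m" "\<beta> < m"
      unfolding Y_def by auto
    show ?thesis
      using kraus_toeplitz_test[OF z p(3-6), of n L W] kraus_toeplitz_test[OF z p(3-6), of n 1 "\<lambda>_. V"]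
        eq[OF toeplitz_test_in[OF z m, of n \<alpha> \<beta>]] unfolding p(1,2) by simp
  qed
  note rank1 = rank_one_gram[where Y = Y and L = L and l = l and
      s = "\<lambda>l p. poly (col_poly n m (W l) p) z" and q = "\<lambda>p. poly (col_poly n m V p) z" for z,
      OF gram l]
  have "\<exists>c. \<forall>y\<in>Y. col_poly n m (W l) y = smult c (col_poly n m V y)"
  proof (rule proportional_poly_family)
    show "cmod z = 1" if "\<And>y. y \<in> Y \<Longrightarrow> poly (col_poly n m V y) z = 0" for z
      using that by (intro roots) (simp add: Y_def)
    show "col_poly n m (W l) x * col_poly n m V y = col_poly n m (W l) y * col_poly n m V x"
      if "x \<in> Y" "y \<in> Y" for x y
      by (rule poly_eq_on_circle) (use rank1(1) that in auto)
    show "cmod (poly (col_poly n m (W l) x) z) \<le> cmod (poly (col_poly n m V x) z)"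
      if "x \<in> Y" "cmod z = 1" for x z
      using rank1(2) that by auto
    show "(a0, x0) \<in> Y" using top by (simp add: Y_def)
    have c: "coeff (col_poly n m V (a0, x0)) (n - 1) \<noteq> 0" using top n by (simp add: coeff_col_poly)
    then show "col_poly n m V (a0, x0) \<noteq> 0" by auto
    show "degree (col_poly n m (W l) (a0, x0)) \<le> degree (col_poly n m V (a0, x0))"
      using degree_col_poly[of n m "W l" a0 x0] le_degree[OF c] by linarith
  qed
  then show ?thesis unfolding Y_def using col_poly_eqD by metis
qed

section \<open>Purity from roots on the circle\<close>

text \<open>\<open>Q\<^sub>V\<close> has degree \<open>n - 1\<close>, that is, the top block of \<open>V\<close> (the rows \<open>a < m\<close>) is nonzero, and vanishes
only at points of the unit circle.\<close>

definition roots_on_circle :: "nat \<Rightarrow> nat \<Rightarrow> (nat \<Rightarrow> nat \<Rightarrow> complex) \<Rightarrow> bool" where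
  "roots_on_circle n m V \<longleftrightarrow> (\<exists>a<m. \<exists>x<m. V a x \<noteq> 0) \<and>
     (\<forall>z. (\<forall>a<m. \<forall>x<m. poly (col_poly n m V (a, x)) z = 0) \<longrightarrow> cmod z = 1)"

abbreviation kraus1 :: "nat \<Rightarrow> nat \<Rightarrow> (nat \<Rightarrow> nat \<Rightarrow> complex) \<Rightarrow> complex mat \<Rightarrow> complex mat" where
  "kraus1 d m V \<equiv> kraus d m 1 (\<lambda>_. V)"

lemma kraus_multiples:
  assumes "\<And>l r x. l < L \<Longrightarrow> r < d \<Longrightarrow> x < m \<Longrightarrow> W l r x = c l * V r x"
  shows "kraus d m L W X = complex_of_real (\<Sum>l<L. (cmod (c l))\<^sup>2) \<cdot>\<^sub>m kraus1 d m V X"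
proof (rule eq_matI)
  fix x y
  assume "x < dim_row (complex_of_real (\<Sum>l<L. (cmod (c l))\<^sup>2) \<cdot>\<^sub>m kraus1 d m V X)"
    "y < dim_col (complex_of_real (\<Sum>l<L. (cmod (c l))\<^sup>2) \<cdot>\<^sub>m kraus1 d m V X)"
  then have xy: "x < m" "y < m" by (simp_all add: kraus_def)
  have "kraus d m L W X $$ (x, y)
      = (\<Sum>l<L. \<Sum>a<d. \<Sum>b<d. (c l * cnj (c l)) * (cnj (V a x) * X $$ (a, b) * V b y))"
    unfolding kraus_index[OF xy] using assms xy by (intro sum.cong refl) simp
  also have "\<dots> = (\<Sum>l<L. c l * cnj (c l)) * kraus1 d m V X $$ (x, y)"
    unfolding kraus_index[OF xy] by (simp add: sum_distrib_left[symmetric] sum_distrib_right[symmetric])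
  also have "(\<Sum>l<L. c l * cnj (c l)) = complex_of_real (\<Sum>l<L. (cmod (c l))\<^sup>2)"
    unfolding of_real_sum complex_norm_square ..
  finally show "kraus d m L W X $$ (x, y)
      = (complex_of_real (\<Sum>l<L. (cmod (c l))\<^sup>2) \<cdot>\<^sub>m kraus1 d m V X) $$ (x, y)"
    using xy by (simp add: kraus_def)
qed (simp_all add: kraus_def)

lemma kraus_append:
  "kraus d m (L + L') (\<lambda>l. if l < L then W l else W' (l - L)) X = kraus d m L W X + kraus d m L' W' X"
proof -
  have split_sum: "(\<Sum>l<L + L'. f (if l < L then W l else W' (l - L))) = (\<Sum>l<L. f (W l)) + (\<Sum>l<L'. f (W' l))"
    for f :: "_ \<Rightarrow> complex"
    by (induction L') (simp_all add: algebra_simps)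
  show ?thesis
  proof (rule eq_matI)
    fix x y assume "x < dim_row (kraus d m L W X + kraus d m L' W' X)" "y < dim_col (kraus d m L W X + kraus d m L' W' X)"
    then have xy: "x < m" "y < m" by (simp_all add: kraus_def)
    show "kraus d m (L + L') (\<lambda>l. if l < L then W l else W' (l - L)) X $$ (x, y)
        = (kraus d m L W X + kraus d m L' W' X) $$ (x, y)"
      using xy split_sum[of "\<lambda>U. \<Sum>a<d. \<Sum>b<d. cnj (U a x) * X $$ (a, b) * U b y"]
      by (simp add: kraus_def)
  qed (simp_all add: kraus_def)
qed

lemma kraus_of_dominated:
  assumes S: "operator_system d S" and dm: "0 < d" "0 < m"
    and \<phi>C: "\<And>X. X \<in> S \<Longrightarrow> \<phi> X \<in> carrier_mat m m"
    and cp: "completely_positive d S m \<psi>" "completely_positive d S m (\<lambda>X. \<phi> X - \<psi> X)"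
  shows "\<exists>L W L' W'. (\<forall>X\<in>S. \<psi> X = kraus d m L W X) \<and>
    (\<forall>X\<in>S. \<phi> X = kraus d m (L + L') (\<lambda>l. if l < L then W l else W' (l - L)) X)"
proof -
  obtain L W where W: "\<And>X. X \<in> S \<Longrightarrow> \<psi> X = kraus d m L W X"
    using completely_positive_imp_kraus[OF S cp(1) dm] by metis
  obtain L' W' where W': "\<And>X. X \<in> S \<Longrightarrow> \<phi> X - \<psi> X = kraus d m L' W' X"
    using completely_positive_imp_kraus[OF S cp(2) dm] by metis
  have "\<phi> X = kraus d m (L + L') (\<lambda>l. if l < L then W l else W' (l - L)) X" if "X \<in> S" for X
  proof -
    have "\<psi> X \<in> carrier_mat m m" using W[OF that] by simp
    then have "\<phi> X = \<psi> X + (\<phi> X - \<psi> X)"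
      using \<phi>C[OF that] by (intro eq_matI) auto
    then show ?thesis
      unfolding kraus_append W[OF that, symmetric] W'[OF that, symmetric] .
  qed
  with W show ?thesis by blast
qed

lemma kraus_operators_multiples:
  assumes n: "0 < n" and V: "roots_on_circle n m V"
    and eq: "\<And>T. T \<in> block_toeplitz n m \<Longrightarrow> kraus (n * m) m L W T = kraus1 (n * m) m V T"
  obtains c where "\<And>l r x. l < L \<Longrightarrow> r < n * m \<Longrightarrow> x < m \<Longrightarrow> W l r x = c l * V r x"
proof -
  from V obtain a0 x0 where "a0 < m" "x0 < m" "V a0 x0 \<noteq> 0" unfolding roots_on_circle_def by blast
  moreover have "cmod z = 1" if "\<And>a x. a < m \<Longrightarrow> x < m \<Longrightarrow> poly (col_poly n m V (a, x)) z = 0" for z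
    using V that unfolding roots_on_circle_def by blast
  ultimately have "\<forall>l. \<exists>c. l < L \<longrightarrow> (\<forall>r<n * m. \<forall>x<m. W l r x = c * V r x)"
    using kraus_rigidity[OF n eq] by blast
  then obtain c where "\<forall>l. l < L \<longrightarrow> (\<forall>r<n * m. \<forall>x<m. W l r x = c l * V r x)" by metis
  then show ?thesis using that by blast
qed

lemma kraus_unital_weights:
  assumes n: "0 < n" "0 < m" and one: "kraus1 (n * m) m V (1\<^sub>m (n * m)) = 1\<^sub>m m"
    and W: "\<And>l r x. l < L \<Longrightarrow> r < n * m \<Longrightarrow> x < m \<Longrightarrow> W l r x = c l * V r x"
    and W1: "kraus (n * m) m L W (1\<^sub>m (n * m)) = 1\<^sub>m m"
  shows "(\<Sum>l<L. (cmod (c l))\<^sup>2) = 1"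
proof -
  have "1\<^sub>m m = complex_of_real (\<Sum>l<L. (cmod (c l))\<^sup>2) \<cdot>\<^sub>m 1\<^sub>m m"
    using kraus_multiples[of L "n * m" m W c V, OF W] one W1 by metis
  then have "1\<^sub>m m $$ (0, 0) = (complex_of_real (\<Sum>l<L. (cmod (c l))\<^sup>2) \<cdot>\<^sub>m 1\<^sub>m m) $$ (0, 0)"
    by (rule arg_cong)
  then have "complex_of_real (\<Sum>l<L. (cmod (c l))\<^sup>2) = 1" using n by simp
  then show ?thesis by (simp only: of_real_eq_1_iff)
qed

lemma one_in_toeplitz: "1\<^sub>m (n * m) \<in> block_toeplitz n m"
  using operator_system_block_toeplitz unfolding operator_system_def by blast

lemma toeplitz_carrier: "T \<in> block_toeplitz n m \<Longrightarrow> T \<in> carrier_mat (n * m) (n * m)"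
  using operator_system_block_toeplitz unfolding operator_system_def by blast

text \<open>A Kraus decomposition of \<open>\<psi>\<close> joined to one of \<open>\<phi> - \<psi>\<close> is one of \<open>\<phi>\<close>, so by rigidity all its operators
are multiples of \<open>V\<close>, and hence \<open>\<psi>\<close> is a multiple of \<open>\<phi>\<close>. Because only the values on block Toeplitz
matrices enter, the argument serves both for the block Toeplitz system itself and for the full matrix algebra.\<close>

lemma pure_of_roots_on_circle:
  assumes nm: "0 < n" "0 < m" and V: "roots_on_circle n m V"
    and S: "operator_system (n * m) S" "block_toeplitz n m \<subseteq> S"
    and \<phi>: "\<And>X. X \<in> S \<Longrightarrow> \<phi> X = kraus1 (n * m) m V X" and one: "\<phi> (1\<^sub>m (n * m)) = 1\<^sub>m m"
  shows "pure (n * m) S m \<phi>"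
  unfolding pure_def
proof (intro allI impI)
  fix \<psi> assume cp: "completely_positive (n * m) S m \<psi> \<and> completely_positive (n * m) S m (\<lambda>X. \<phi> X - \<psi> X)"
  have nm': "0 < n * m" using nm by simp
  have \<phi>C: "\<phi> X \<in> carrier_mat m m" if "X \<in> S" for X using \<phi>[OF that] by simp
  obtain L W L' W' where W: "\<And>X. X \<in> S \<Longrightarrow> \<psi> X = kraus (n * m) m L W X"
    and U': "\<And>X. X \<in> S \<Longrightarrow>
      \<phi> X = kraus (n * m) m (L + L') (\<lambda>l. if l < L then W l else W' (l - L)) X"
    using kraus_of_dominated[where \<phi> = \<phi>, OF S(1) nm' nm(2) \<phi>C conjunct1[OF cp] conjunct2[OF cp]] by blast
  let ?U = "\<lambda>l. if l < L then W l else W' (l - L)"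
  have U: "kraus (n * m) m (L + L') ?U X = kraus1 (n * m) m V X" if "X \<in> S" for X
    using U'[OF that] \<phi>[OF that] by simp
  obtain c where c: "\<And>l r x. l < L + L' \<Longrightarrow> r < n * m \<Longrightarrow> x < m \<Longrightarrow> ?U l r x = c l * V r x"
    using kraus_operators_multiples[OF nm(1) V, of "L + L'" ?U] U S(2) by blast
  have 1: "1\<^sub>m (n * m) \<in> S" using S one_in_toeplitz by blast
  have "(\<Sum>l<L + L'. (cmod (c l))\<^sup>2) = 1"
    by (rule kraus_unital_weights[OF nm _ c]) (use U[OF 1] \<phi>[OF 1] one in auto)
  moreover define t where "t = (\<Sum>l<L. (cmod (c l))\<^sup>2)"
  moreover have "t \<le> (\<Sum>l<L + L'. (cmod (c l))\<^sup>2)"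
    unfolding t_def by (intro sum_mono2) auto
  moreover have "0 \<le> t" unfolding t_def by (intro sum_nonneg) simp
  moreover have "\<psi> X = complex_of_real t \<cdot>\<^sub>m \<phi> X" if "X \<in> S" for X
    unfolding W[OF that] \<phi>[OF that] t_def
  proof (rule kraus_multiples)
    show "W l r x = c l * V r x" if "l < L" "r < n * m" "x < m" for l r x
      using c[of l r x] that by simp
  qed
  ultimately show "\<exists>t::real. 0 \<le> t \<and> t \<le> 1 \<and> (\<forall>X\<in>S. \<psi> X = complex_of_real t \<cdot>\<^sub>m \<phi> X)"
    by (intro exI[of _ t]) auto
qed

text \<open>Rigidity makes the Kraus operators of any extension multiples of \<open>V\<close>, and unitality makes their weights
add up to one.\<close>

lemma unique_extension_of_roots_on_circle:
  assumes nm: "0 < n" "0 < m" and V: "roots_on_circle n m V"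
    and \<Psi>: "ucp (n * m) (carrier_mat (n * m) (n * m)) m \<Psi>"
    and ext: "\<And>T. T \<in> block_toeplitz n m \<Longrightarrow> \<Psi> T = kraus1 (n * m) m V T"
    and X: "X \<in> carrier_mat (n * m) (n * m)"
  shows "\<Psi> X = kraus1 (n * m) m V X"
proof -
  have nm': "0 < n * m" using nm by simp
  have cp: "completely_positive (n * m) (carrier_mat (n * m) (n * m)) m \<Psi>"
    and one: "\<Psi> (1\<^sub>m (n * m)) = 1\<^sub>m m" using \<Psi> unfolding ucp_def by auto
  obtain L W where W: "\<And>X. X \<in> carrier_mat (n * m) (n * m) \<Longrightarrow> \<Psi> X = kraus (n * m) m L W X"
    using completely_positive_imp_kraus[OF operator_system_carrier cp nm' nm(2)] by metis
  obtain c where c: "\<And>l r x. l < L \<Longrightarrow> r < n * m \<Longrightarrow> x < m \<Longrightarrow> W l r x = c l * V r x"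
    using kraus_operators_multiples[OF nm(1) V, of L W] ext W toeplitz_carrier by metis
  have "(\<Sum>l<L. (cmod (c l))\<^sup>2) = 1"
    by (rule kraus_unital_weights[OF nm _ c]) (use W[of "1\<^sub>m (n * m)"] one ext[OF one_in_toeplitz] in auto)
  then have "\<Psi> X = complex_of_real 1 \<cdot>\<^sub>m kraus1 (n * m) m V X"
    unfolding W[OF X] using kraus_multiples[of L "n * m" m W c V X, OF c] by simp
  also have "\<dots> = kraus1 (n * m) m V X" by (intro eq_matI) (simp_all add: kraus_def)
  finally show ?thesis .
qed

text \<open>Each summand of a Kraus decomposition is dominated by \<open>\<phi>\<close>, so purity makes it a multiple of \<open>\<phi>\<close>; one of
these multiples is nonzero, and rescaling it gives \<open>\<phi>\<close>.\<close>

lemma pure_imp_kraus1: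
  assumes S: "operator_system d S" and dm: "0 < d" "0 < m"
    and ucp: "ucp d S m \<phi>" and pure: "pure d S m \<phi>"
  obtains V where "\<And>X. X \<in> S \<Longrightarrow> \<phi> X = kraus1 d m V X"
proof -
  have cp: "completely_positive d S m \<phi>" and one: "\<phi> (1\<^sub>m d) = 1\<^sub>m m" using ucp unfolding ucp_def by auto
  have 1: "1\<^sub>m d \<in> S" using S unfolding operator_system_def by blast
  obtain L W where W: "\<And>X. X \<in> S \<Longrightarrow> \<phi> X = kraus d m L W X"
    using completely_positive_imp_kraus[OF S cp dm] by metis
  have "\<exists>t\<ge>0. \<forall>X\<in>S. kraus1 d m (W l) X = complex_of_real t \<cdot>\<^sub>m \<phi> X" if l: "l < L" for l
  proof -
    have "completely_positive d S m (kraus1 d m (W l))"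
      by (rule completely_positive_kraus[OF S dm refl])
    moreover have "completely_positive d S m (\<lambda>X. \<phi> X - kraus1 d m (W l) X)"
    proof (rule completely_positive_kraus[OF S dm])
      fix X assume X: "X \<in> S"
      let ?f = "\<lambda>k x y. \<Sum>a<d. \<Sum>b<d. cnj (W k a x) * X $$ (a, b) * W k b y"
      have "(\<Sum>k<L. ?f k x y) = ?f l x y + (\<Sum>k<L. if k = l then 0 else ?f k x y)" for x y
        using l by (simp add: sum.remove[of "{..<L}" l] sum.If_cases Diff_eq)
      moreover have "(\<Sum>k<L. if k = l then 0 else ?f k x y)
        = (\<Sum>k<L. \<Sum>a<d. \<Sum>b<d. cnj ((if k = l then (\<lambda>_ _. 0) else W k) a x) * X $$ (a, b)
             * (if k = l then (\<lambda>_ _. 0) else W k) b y)" for x y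
        by (intro sum.cong refl) auto
      ultimately show "\<phi> X - kraus1 d m (W l) X = kraus d m L (\<lambda>k. if k = l then (\<lambda>_ _. 0) else W k) X"
        unfolding W[OF X] by (intro eq_matI) (simp_all add: kraus_def)
    qed
    ultimately show ?thesis using pure unfolding pure_def by blast
  qed
  then obtain t where t: "\<And>l. l < L \<Longrightarrow> 0 \<le> t l"
    "\<And>l X. l < L \<Longrightarrow> X \<in> S \<Longrightarrow> kraus1 d m (W l) X = complex_of_real (t l) \<cdot>\<^sub>m \<phi> X" by metis
  have "\<exists>l<L. t l \<noteq> 0"
  proof (rule ccontr)
    assume "\<not> (\<exists>l<L. t l \<noteq> 0)"
    then have zero: "kraus1 d m (W l) (1\<^sub>m d) $$ (0, 0) = 0" if "l < L" for l
      using t(2)[OF that 1] that one dm by simp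
    have "(1::complex) = kraus d m L W (1\<^sub>m d) $$ (0, 0)"
      using W[OF 1] one dm by (metis index_one_mat(1))
    also have "\<dots> = (\<Sum>l<L. kraus1 d m (W l) (1\<^sub>m d) $$ (0, 0))"
      using dm by (simp add: kraus_def)
    also have "\<dots> = 0" using zero by simp
    finally show False by simp
  qed
  then obtain l where l: "l < L" "0 < t l" using t(1) by (metis less_le)
  define V where "V r x = complex_of_real (1 / sqrt (t l)) * W l r x" for r x
  have "\<phi> X = kraus1 d m V X" if X: "X \<in> S" for X
  proof -
    have "kraus1 d m V X = complex_of_real (\<Sum>k<(1::nat). (cmod (complex_of_real (1 / sqrt (t l))))\<^sup>2) \<cdot>\<^sub>m kraus1 d m (W l) X"
      by (rule kraus_multiples) (simp add: V_def)
    also have "(\<Sum>k<(1::nat). (cmod (complex_of_real (1 / sqrt (t l))))\<^sup>2) = 1 / t l"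
      unfolding norm_of_real using l(2) by (simp add: power_divide)
    also have "complex_of_real (1 / t l) \<cdot>\<^sub>m kraus1 d m (W l) X = \<phi> X"
      unfolding t(2)[OF l(1) X] using l(2) W[OF X] by (intro eq_matI) auto
    finally show ?thesis ..
  qed
  then show ?thesis by (rule that)
qed

section \<open>Roots on the circle from purity\<close>

lemma kraus1_toeplitz:
  assumes xy: "x < m" "y < m"
  shows "kraus1 (n * m) m V (block_mat n m (\<lambda>i j. T (int i - int j))) $$ (x, y)
    = (\<Sum>a<m. \<Sum>b<m. \<Sum>k<n. \<Sum>l<n. cnj (coeff (col_poly n m V (a, x)) k)
         * T (int l - int k) $$ (a, b) * coeff (col_poly n m V (b, y)) l)"
proof -
  have m: "0 < m" using xy by simp
  define g where "g a b k l = cnj (coeff (col_poly n m V (a, x)) k)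
      * T (int l - int k) $$ (a, b) * coeff (col_poly n m V (b, y)) l" for a b k l
  have "kraus1 (n * m) m V (block_mat n m (\<lambda>i j. T (int i - int j))) $$ (x, y)
      = (\<Sum>i<n. \<Sum>a<m. \<Sum>j<n. \<Sum>b<m. g a b (n - Suc i) (n - Suc j))"
    unfolding kraus_index[OF xy] sum_blocks[OF m] sum.cartesian_product'
    by (simp add: block_mat_def block_index_less g_def coeff_col_poly of_nat_diff)
  also have "\<dots> = (\<Sum>a<m. \<Sum>b<m. \<Sum>i<n. \<Sum>j<n. g a b (n - Suc i) (n - Suc j))"
    unfolding sum.cartesian_product
    by (rule sum.reindex_bij_witness[of _ "\<lambda>(a, b, i, j). (i, a, j, b)" "\<lambda>(i, a, j, b). (a, b, i, j)"]) auto
  also have "\<dots> = (\<Sum>a<m. \<Sum>b<m. \<Sum>k<n. \<Sum>l<n. g a b k l)"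
  proof (rule sum.cong[OF refl], rule sum.cong[OF refl])
    fix a b
    have "(\<Sum>i<n. \<Sum>j<n. g a b (n - Suc i) (n - Suc j)) = (\<Sum>i<n. \<Sum>l<n. g a b (n - Suc i) l)"
      by (rule sum.cong[OF refl], rule sum.nat_diff_reindex)
    also have "\<dots> = (\<Sum>k<n. \<Sum>l<n. g a b k l)" by (rule sum.nat_diff_reindex)
    finally show "(\<Sum>i<n. \<Sum>j<n. g a b (n - Suc i) (n - Suc j)) = (\<Sum>k<n. \<Sum>l<n. g a b k l)" .
  qed
  finally show ?thesis unfolding g_def .
qed

lemma coeff_linear_mult:
  fixes \<alpha> \<beta> :: complex
  shows "coeff ([:\<beta>, \<alpha>:] * R) k = \<beta> * coeff R k + \<alpha> * (case k of 0 \<Rightarrow> 0 | Suc j \<Rightarrow> coeff R j)"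
  by (simp add: coeff_pCons split: nat.split)

text \<open>The Toeplitz form of the polynomials \<open>(\<beta> + \<alpha>z) R\<close> and \<open>(\<beta> + \<alpha>z) R'\<close> depends on \<open>\<alpha>\<close> and \<open>\<beta>\<close> only through the
coefficients of \<open>\<bar>\<beta> + \<alpha>z\<bar>\<^sup>2\<close> as a trigonometric polynomial on the circle, so decompositions of the latter lift to the
form.\<close>

lemma linear_factor_form:
  fixes \<tau> :: "int \<Rightarrow> complex" and \<alpha> \<beta> :: complex
  assumes "coeff R N = 0" "coeff R' N = 0"
  shows "(\<Sum>k<Suc N. \<Sum>l<Suc N. cnj (coeff ([:\<beta>, \<alpha>:] * R) k) * \<tau> (int l - int k) * coeff ([:\<beta>, \<alpha>:] * R') l)
    = (\<Sum>k<N. \<Sum>l<N. cnj (coeff R k) * coeff R' l * ((\<alpha> * cnj \<alpha> + \<beta> * cnj \<beta>) * \<tau> (int l - int k)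
        + (\<alpha> * cnj \<beta>) * \<tau> (int l + 1 - int k) + cnj (\<alpha> * cnj \<beta>) * \<tau> (int l - int k - 1)))"
proof -
  have right: "(\<Sum>l<Suc N. g l * coeff ([:\<beta>, \<alpha>:] * R') l) = (\<Sum>l<N. coeff R' l * (\<beta> * g l + \<alpha> * g (Suc l)))" for g
  proof -
    have "(\<Sum>l<Suc N. g l * coeff ([:\<beta>, \<alpha>:] * R') l) = (\<Sum>l<Suc N. g l * (\<beta> * coeff R' l))
       + (\<Sum>l<Suc N. g l * (\<alpha> * (case l of 0 \<Rightarrow> 0 | Suc j \<Rightarrow> coeff R' j)))"
      unfolding coeff_linear_mult distrib_left sum.distrib ..
    also have "(\<Sum>l<Suc N. g l * (\<beta> * coeff R' l)) = (\<Sum>l<N. g l * (\<beta> * coeff R' l))"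
      using assms(2) by simp
    also have "(\<Sum>l<Suc N. g l * (\<alpha> * (case l of 0 \<Rightarrow> 0 | Suc j \<Rightarrow> coeff R' j)))
        = (\<Sum>l<N. g (Suc l) * (\<alpha> * coeff R' l))"
      by (subst sum.lessThan_Suc_shift) (simp add: mult_ac)
    finally show ?thesis
      unfolding sum.distrib[symmetric] by (rule trans) (intro sum.cong refl, simp add: algebra_simps)
  qed
  have left: "(\<Sum>k<Suc N. cnj (coeff ([:\<beta>, \<alpha>:] * R) k) * f k)
      = (\<Sum>k<N. cnj (coeff R k) * (cnj \<beta> * f k + cnj \<alpha> * f (Suc k)))" for f
  proof -
    have "(\<Sum>k<Suc N. cnj (coeff ([:\<beta>, \<alpha>:] * R) k) * f k) = (\<Sum>k<Suc N. cnj (coeff R k) * (cnj \<beta> * f k))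
       + (\<Sum>k<Suc N. cnj (\<alpha> * (case k of 0 \<Rightarrow> 0 | Suc j \<Rightarrow> coeff R j)) * f k)"
      unfolding sum.distrib[symmetric] coeff_linear_mult by (intro sum.cong refl) (simp add: algebra_simps)
    also have "(\<Sum>k<Suc N. cnj (coeff R k) * (cnj \<beta> * f k)) = (\<Sum>k<N. cnj (coeff R k) * (cnj \<beta> * f k))"
      using assms(1) by simp
    also have "(\<Sum>k<Suc N. cnj (\<alpha> * (case k of 0 \<Rightarrow> 0 | Suc j \<Rightarrow> coeff R j)) * f k)
        = (\<Sum>k<N. cnj (coeff R k) * (cnj \<alpha> * f (Suc k)))"
      by (subst sum.lessThan_Suc_shift) (simp add: mult_ac)
    finally show ?thesis
      unfolding sum.distrib[symmetric] by (rule trans) (intro sum.cong refl, simp add: algebra_simps)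
  qed
  have "(\<Sum>k<Suc N. \<Sum>l<Suc N. cnj (coeff ([:\<beta>, \<alpha>:] * R) k) * \<tau> (int l - int k) * coeff ([:\<beta>, \<alpha>:] * R') l)
      = (\<Sum>k<Suc N. cnj (coeff ([:\<beta>, \<alpha>:] * R) k) *
          (\<Sum>l<N. coeff R' l * (\<beta> * \<tau> (int l - int k) + \<alpha> * \<tau> (int (Suc l) - int k))))"
    by (rule sum.cong[OF refl], subst right[symmetric]) (simp only: sum_distrib_left mult.assoc)
  also have "\<dots> = (\<Sum>k<N. cnj (coeff R k) *
        (cnj \<beta> * (\<Sum>l<N. coeff R' l * (\<beta> * \<tau> (int l - int k) + \<alpha> * \<tau> (int (Suc l) - int k)))
       + cnj \<alpha> * (\<Sum>l<N. coeff R' l * (\<beta> * \<tau> (int l - int (Suc k)) + \<alpha> * \<tau> (int (Suc l) - int (Suc k))))))"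
    by (rule left)
  also have "\<dots> = (\<Sum>k<N. \<Sum>l<N. cnj (coeff R k) * coeff R' l * ((\<alpha> * cnj \<alpha> + \<beta> * cnj \<beta>) * \<tau> (int l - int k)
        + (\<alpha> * cnj \<beta>) * \<tau> (int l + 1 - int k) + cnj (\<alpha> * cnj \<beta>) * \<tau> (int l - int k - 1)))"
    unfolding sum_distrib_left sum.distrib[symmetric] sum_distrib_left
    by (intro sum.cong refl) (simp add: algebra_simps)
  finally show ?thesis .
qed

text \<open>Inverse of \<open>col_poly\<close> on entries of degree below \<open>n\<close>.\<close>

definition poly_col :: "nat \<Rightarrow> nat \<Rightarrow> (nat \<times> nat \<Rightarrow> complex poly) \<Rightarrow> nat \<Rightarrow> nat \<Rightarrow> complex" where
  "poly_col n m P r x = coeff (P (r mod m, x)) (n - 1 - r div m)"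

lemma col_poly_poly_col:
  assumes "a < m" "\<And>k. n \<le> k \<Longrightarrow> coeff (P (a, x)) k = 0"
  shows "col_poly n m (poly_col n m P) (a, x) = P (a, x)"
  using assms by (intro poly_eqI) (auto simp: coeff_col_poly poly_col_def)

lemma kraus1_linear_factor:
  assumes n: "n = Suc N" and xy: "x < m" "y < m"
    and R: "\<And>a x. a < m \<Longrightarrow> x < m \<Longrightarrow> coeff (R (a, x)) N = 0"
    and P: "\<And>a x. a < m \<Longrightarrow> x < m \<Longrightarrow> col_poly n m V (a, x) = [:\<beta>, \<alpha>:] * R (a, x)"
  shows "kraus1 (n * m) m V (block_mat n m (\<lambda>i j. T (int i - int j))) $$ (x, y)
    = (\<Sum>a<m. \<Sum>b<m. \<Sum>k<N. \<Sum>l<N. cnj (coeff (R (a, x)) k) * coeff (R (b, y)) l *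
        ((\<alpha> * cnj \<alpha> + \<beta> * cnj \<beta>) * T (int l - int k) $$ (a, b)
        + (\<alpha> * cnj \<beta>) * T (int l + 1 - int k) $$ (a, b) + cnj (\<alpha> * cnj \<beta>) * T (int l - int k - 1) $$ (a, b)))"
  unfolding kraus1_toeplitz[OF xy] unfolding n
proof (rule sum.cong[OF refl], rule sum.cong[OF refl])
  fix a b assume "a \<in> {..<m}" "b \<in> {..<m}"
  then have ab: "a < m" "b < m" by auto
  show "(\<Sum>k<Suc N. \<Sum>l<Suc N. cnj (coeff (col_poly (Suc N) m V (a, x)) k) * T (int l - int k) $$ (a, b) *
          coeff (col_poly (Suc N) m V (b, y)) l)
    = (\<Sum>k<N. \<Sum>l<N. cnj (coeff (R (a, x)) k) * coeff (R (b, y)) l *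
        ((\<alpha> * cnj \<alpha> + \<beta> * cnj \<beta>) * T (int l - int k) $$ (a, b)
        + (\<alpha> * cnj \<beta>) * T (int l + 1 - int k) $$ (a, b) + cnj (\<alpha> * cnj \<beta>) * T (int l - int k - 1) $$ (a, b)))"
    unfolding P[OF ab(1) xy(1), unfolded n] P[OF ab(2) xy(2), unfolded n]
    by (rule linear_factor_form[of "R (a, x)" N "R (b, y)" \<beta> \<alpha> "\<lambda>k. T k $$ (a, b)"])
       (use R ab xy in auto)
qed

lemma unimodular_polar:
  fixes w :: complex
  obtains v where "cmod v = 1" "w = of_real (cmod w) * v"
proof (cases "w = 0")
  case True
  then show ?thesis using that[of 1] by simp
next
  case False
  then show ?thesis using that[of "w / of_real (cmod w)"] by (simp add: norm_divide)
qed

text \<open>Choose a unimodular \<open>v\<close> with \<open>\<alpha> * cnj \<beta> = \<bar>\<alpha> * \<beta>\<bar> * v\<close>. On the circle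
\<open>\<bar>\<beta> + \<alpha>z\<bar>\<^sup>2 = s\<^sup>2 \<bar>1 + v z\<bar>\<^sup>2 + d\<^sup>2 \<bar>1 - v z\<bar>\<^sup>2\<close> with \<open>s = (\<bar>\<alpha>\<bar> + \<bar>\<beta>\<bar>) / 2\<close> and \<open>d = (\<bar>\<alpha>\<bar> - \<bar>\<beta>\<bar>) / 2\<close>,
both nonzero. This splits \<open>\<phi>\<close> into two compressions; if the first were \<open>t\<close> times \<open>\<phi>\<close>, comparing at the
zeros of \<open>1 + v z\<close> and of \<open>1 - v z\<close> would give \<open>t = 0\<close> and \<open>s = 0\<close>. The zeros of \<open>R\<close> do not disturb the
comparison, since they are finitely many. The case \<open>\<alpha> = 0\<close>, \<open>\<beta> = 1\<close> covers a \<open>Q\<^sub>V\<close> of too small degree.\<close>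

lemma not_pure_of_linear_factor:
  fixes \<alpha> \<beta> :: complex
  assumes n: "n = Suc N" and m: "0 < m"
    and \<phi>: "\<And>T. T \<in> block_toeplitz n m \<Longrightarrow> \<phi> T = kraus1 (n * m) m V T"
    and one: "\<phi> (1\<^sub>m (n * m)) = 1\<^sub>m m"
    and R: "\<And>a x k. a < m \<Longrightarrow> x < m \<Longrightarrow> N \<le> k \<Longrightarrow> coeff (R (a, x)) k = 0"
    and P: "\<And>a x. a < m \<Longrightarrow> x < m \<Longrightarrow> col_poly n m V (a, x) = [:\<beta>, \<alpha>:] * R (a, x)"
    and ne: "cmod \<alpha> \<noteq> cmod \<beta>"
  shows "\<not> pure (n * m) (block_toeplitz n m) m \<phi>"
proof
  assume pure: "pure (n * m) (block_toeplitz n m) m \<phi>"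
  obtain v where v: "cmod v = 1" "\<alpha> * cnj \<beta> = of_real (cmod (\<alpha> * cnj \<beta>)) * v"
    by (rule unimodular_polar)
  define s where "s = (cmod \<alpha> + cmod \<beta>) / 2"
  define d where "d = (cmod \<alpha> - cmod \<beta>) / 2"
  have d: "d \<noteq> 0" using ne by (simp add: d_def)
  have s: "s \<noteq> 0"
  proof
    assume "s = 0"
    then show False using ne by (simp add: s_def add_nonneg_eq_0_iff)
  qed
  define P1 where "P1 p = [:of_real s, of_real s * v:] * R p" for p
  define P2 where "P2 p = [:of_real d, - (of_real d * v):] * R p" for p
  define V1 where "V1 = poly_col n m P1"
  define V2 where "V2 = poly_col n m P2"
  have deg: "coeff ([:\<beta>', \<alpha>':] * R (a, x)) k = 0" if "a < m" "x < m" "n \<le> k" for \<alpha>' \<beta>' a x k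
    unfolding coeff_linear_mult using that R n by (simp split: nat.split)
  have col1: "col_poly n m V1 (a, x) = P1 (a, x)" if "a < m" "x < m" for a x
    unfolding V1_def by (rule col_poly_poly_col[OF that(1)]) (simp only: P1_def deg[OF that])
  have col2: "col_poly n m V2 (a, x) = P2 (a, x)" if "a < m" "x < m" for a x
    unfolding V2_def by (rule col_poly_poly_col[OF that(1)]) (simp only: P2_def deg[OF that])
  have vv: "v * cnj v = 1" by (rule circle_cnj_mult[OF v(1)])
  have c1: "\<alpha> * cnj \<alpha> + \<beta> * cnj \<beta>
      = (of_real s * v * cnj (of_real s * v) + of_real s * cnj (of_real s))
      + (- (of_real d * v) * cnj (- (of_real d * v)) + of_real d * cnj (of_real d))"
  proof -
    have "(of_real s * v * cnj (of_real s * v) + of_real s * cnj (of_real s))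
      + (- (of_real d * v) * cnj (- (of_real d * v)) + of_real d * cnj (of_real d))
      = of_real (s * s + d * d) * (v * cnj v) + of_real (s * s + d * d)" by (simp add: algebra_simps)
    also have "\<dots> = of_real (2 * (s * s + d * d))"
      unfolding vv by simp
    also have "2 * (s * s + d * d) = (cmod \<alpha>)\<^sup>2 + (cmod \<beta>)\<^sup>2"
      by (simp add: s_def d_def power2_eq_square field_simps)
    also have "\<dots> = \<alpha> * cnj \<alpha> + \<beta> * cnj \<beta>" unfolding of_real_add complex_norm_square ..
    finally show ?thesis by simp
  qed
  have c2: "\<alpha> * cnj \<beta> = of_real s * v * cnj (of_real s) + - (of_real d * v) * cnj (of_real d)"
  proof -
    have "of_real s * v * cnj (of_real s) + - (of_real d * v) * cnj (of_real d) = of_real (s * s - d * d) * v"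
      by (simp add: algebra_simps)
    also have "s * s - d * d = cmod (\<alpha> * cnj \<beta>)"
      by (simp add: s_def d_def norm_mult field_simps)
    finally show ?thesis using v(2) by simp
  qed
  have nm': "0 < n * m" using n m by simp
  note OS = operator_system_block_toeplitz[of n m]
  have sum: "\<phi> T = kraus1 (n * m) m V1 T + kraus1 (n * m) m V2 T" if T: "T \<in> block_toeplitz n m" for T
  proof -
    from T obtain T' where T': "T = block_mat n m (\<lambda>i j. T' (int i - int j))"
      unfolding block_toeplitz_def by blast
    have "kraus1 (n * m) m V T $$ (x, y) = kraus1 (n * m) m V1 T $$ (x, y) + kraus1 (n * m) m V2 T $$ (x, y)"
      if xy: "x < m" "y < m" for x y
    proof -
      note F = kraus1_linear_factor[OF n xy, where R = R and T = T', folded T']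
      have R0: "coeff (R (a, x)) N = 0" if "a < m" "x < m" for a x using R[OF that] by simp
      note e = F[where V = V, OF R0 P, unfolded c1 c2] F[where V = V1, OF R0 col1[unfolded P1_def]]
          F[where V = V2, OF R0 col2[unfolded P2_def]]
      show ?thesis
        by (simp only: e sum.distrib[symmetric], intro sum.cong refl) (simp add: algebra_simps)
    qed
    then show ?thesis unfolding \<phi>[OF T] by (intro eq_matI) (simp_all add: kraus_def)
  qed
  have "completely_positive (n * m) (block_toeplitz n m) m (kraus1 (n * m) m V1)"
    by (rule completely_positive_kraus[OF OS nm' m refl])
  moreover have "completely_positive (n * m) (block_toeplitz n m) m (\<lambda>T. \<phi> T - kraus1 (n * m) m V1 T)"
  proof (rule completely_positive_kraus[OF OS nm' m])
    show "\<phi> T - kraus1 (n * m) m V1 T = kraus1 (n * m) m V2 T" if "T \<in> block_toeplitz n m" for T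
      unfolding sum[OF that] by (intro eq_matI) (simp_all add: kraus_def)
  qed
  ultimately obtain t where t: "\<And>T. T \<in> block_toeplitz n m \<Longrightarrow> kraus1 (n * m) m V1 T = complex_of_real t \<cdot>\<^sub>m \<phi> T"
    using pure unfolding pure_def by blast
  have "\<exists>a<m. \<exists>x<m. R (a, x) \<noteq> 0"
  proof (rule ccontr)
    assume "\<not> (\<exists>a<m. \<exists>x<m. R (a, x) \<noteq> 0)"
    then have "col_poly n m V (a, x) = 0" if "a < m" "x < m" for a x using P that by auto
    then have "col_poly n m V y = smult 0 (col_poly n m V y)" if "y \<in> {..<m} \<times> {..<m}" for y
      using that by auto
    from col_poly_eqD[OF this] have V0: "V r x = 0" if "r < n * m" "x < m" for r x
      using that by fastforce
    have "(1::complex) = \<phi> (1\<^sub>m (n * m)) $$ (0, 0)" using one m by simp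
    also have "\<dots> = 0" unfolding \<phi>[OF one_in_toeplitz] using m by (simp add: kraus_def V0)
    finally show False by simp
  qed
  then obtain a x where ax: "a < m" "x < m" "R (a, x) \<noteq> 0" by blast
  \<comment> \<open>The entries \<open>(x, x)\<close> of the first compression and of \<open>t * \<phi>\<close> at the test matrix \<open>(a, a)\<close>,
    after division by \<open>\<bar>R z\<bar>\<^sup>2\<close>.\<close>
  define f where "f z = (s * cmod (1 + v * z))\<^sup>2" for z
  define g where "g z = t * ((s * cmod (1 + v * z))\<^sup>2 + (d * cmod (1 - v * z))\<^sup>2)" for z
  have fg: "f z = g z" if z: "cmod z = 1" "z \<notin> {z. poly (R (a, x)) z = 0}" for z
  proof -
    define T where "T = toeplitz_test n m z a a"
    have T: "T \<in> block_toeplitz n m" unfolding T_def by (rule toeplitz_test_in[OF z(1) m])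
    have k: "kraus1 (n * m) m U T $$ (x, x) = of_real ((cmod (poly (col_poly n m U (a, x)) z))\<^sup>2)" for U
      unfolding T_def kraus_toeplitz_test[OF z(1) ax(2) ax(2) ax(1) ax(1)] complex_norm_square
      by (simp add: mult.commute)
    have p1: "cmod (poly (col_poly n m V1 (a, x)) z) = \<bar>s\<bar> * cmod (1 + v * z) * cmod (poly (R (a, x)) z)"
    proof -
      have "poly (P1 (a, x)) z = of_real s * (1 + v * z) * poly (R (a, x)) z"
        by (simp add: P1_def algebra_simps)
      then show ?thesis unfolding col1[OF ax(1,2)] by (simp add: norm_mult)
    qed
    have p2: "cmod (poly (col_poly n m V2 (a, x)) z) = \<bar>d\<bar> * cmod (1 - v * z) * cmod (poly (R (a, x)) z)"
    proof -
      have "poly (P2 (a, x)) z = of_real d * (1 - v * z) * poly (R (a, x)) z"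
        by (simp add: P2_def algebra_simps)
      then show ?thesis unfolding col2[OF ax(1,2)] by (simp add: norm_mult)
    qed
    have "kraus1 (n * m) m V1 T $$ (x, x)
        = of_real t * (kraus1 (n * m) m V1 T $$ (x, x) + kraus1 (n * m) m V2 T $$ (x, x))"
      using arg_cong[OF t[OF T], of "\<lambda>M. M $$ (x, x)"] ax(2) unfolding sum[OF T] by (simp add: kraus_def)
    then have "(\<bar>s\<bar> * cmod (1 + v * z) * cmod (poly (R (a, x)) z))\<^sup>2
        = t * ((\<bar>s\<bar> * cmod (1 + v * z) * cmod (poly (R (a, x)) z))\<^sup>2
            + (\<bar>d\<bar> * cmod (1 - v * z) * cmod (poly (R (a, x)) z))\<^sup>2)"
      unfolding k p1 p2 of_real_add[symmetric] of_real_mult[symmetric] of_real_eq_iff .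
    then have "f z * (cmod (poly (R (a, x)) z))\<^sup>2 = g z * (cmod (poly (R (a, x)) z))\<^sup>2"
      by (simp add: f_def g_def power_mult_distrib algebra_simps)
    then show ?thesis using z(2) by simp
  qed
  have F: "finite {z. poly (R (a, x)) z = 0}" by (rule poly_roots_finite[OF ax(3)])
  have cont: "isCont f z" "isCont g z" for z
    unfolding f_def g_def by (auto intro!: continuous_intros)
  have eq: "f z = g z" if "cmod z = 1" for z
  proof (rule antisym)
    show "f z \<le> g z" by (rule circle_le_cofinite[OF cont F _ that], rule eq_refl, rule fg)
    show "g z \<le> f z" by (rule circle_le_cofinite[OF cont(2) cont(1) F _ that], rule eq_refl, rule fg[symmetric])
  qed
  have "t = 0" using eq[of "- cnj v"] v(1) d vv by (simp add: f_def g_def)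
  moreover have "f (cnj v) = (2 * s)\<^sup>2" using vv by (simp add: f_def)
  ultimately show False using eq[of "cnj v"] v(1) s by (simp add: g_def)
qed

text \<open>If the top block vanishes, \<open>Q\<^sub>V\<close> itself has degree below \<open>n - 1\<close> and the linear factor is \<open>1\<close>, with \<open>\<alpha> = 0\<close>
and \<open>\<beta> = 1\<close>; a root \<open>z\<close> off the circle gives the linear factor \<open>X - z\<close>.\<close>

lemma pure_imp_roots_on_circle:
  assumes n: "0 < n" and m: "0 < m"
    and \<phi>: "\<And>T. T \<in> block_toeplitz n m \<Longrightarrow> \<phi> T = kraus1 (n * m) m V T"
    and one: "\<phi> (1\<^sub>m (n * m)) = 1\<^sub>m m"
    and pure: "pure (n * m) (block_toeplitz n m) m \<phi>"
  shows "roots_on_circle n m V"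
proof -
  from n obtain N where N: "n = Suc N" by (cases n) auto
  have P0: "coeff (col_poly n m V (a, x)) k = 0" if "n \<le> k" for a x k
    using that by (simp add: coeff_col_poly)
  have "\<exists>a<m. \<exists>x<m. V a x \<noteq> 0"
  proof (rule ccontr)
    assume V0: "\<not> (\<exists>a<m. \<exists>x<m. V a x \<noteq> 0)"
    have "\<not> pure (n * m) (block_toeplitz n m) m \<phi>"
    proof (rule not_pure_of_linear_factor[OF N m \<phi> one])
      show "coeff (col_poly n m V (a, x)) k = 0" if "a < m" "x < m" "N \<le> k" for a x k
        using V0 that P0[of k a x] by (cases "k = N") (auto simp: coeff_col_poly N)
      show "col_poly n m V (a, x) = [:1, 0:] * col_poly n m V (a, x)" for a x by simp
    qed simp_all
    then show False using pure by blast
  qed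
  moreover have "cmod z = 1" if z: "\<forall>a<m. \<forall>x<m. poly (col_poly n m V (a, x)) z = 0" for z
  proof (rule ccontr)
    assume z1: "cmod z \<noteq> 1"
    define R where "R p = col_poly n m V p div [:- z, 1:]" for p
    have PR: "col_poly n m V (a, x) = [:- z, 1:] * R (a, x)" if "a < m" "x < m" for a x
    proof -
      have "[:- z, 1:] dvd col_poly n m V (a, x)" using z that by (simp flip: poly_eq_0_iff_dvd)
      then show ?thesis unfolding R_def by (simp only: dvd_mult_div_cancel)
    qed
    have "\<not> pure (n * m) (block_toeplitz n m) m \<phi>"
    proof (rule not_pure_of_linear_factor[OF N m \<phi> one _ PR])
      show "coeff (R (a, x)) k = 0" if "a < m" "x < m" "N \<le> k" for a x k
      proof (cases "R (a, x) = 0")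
        case False
        then have "degree (col_poly n m V (a, x)) = 1 + degree (R (a, x))"
          unfolding PR[OF that(1,2)] by (subst degree_mult_eq) auto
        then show ?thesis using degree_col_poly[of n m V a x] that(3) N by (intro coeff_eq_0) simp
      qed simp
      show "cmod 1 \<noteq> cmod (- z)" using z1 by simp
    qed
    then show False using pure by blast
  qed
  ultimately show ?thesis unfolding roots_on_circle_def by blast
qed

section \<open>Block columns and their matrix polynomials\<close>

abbreviation block_entries :: "nat \<Rightarrow> nat \<Rightarrow> (nat \<Rightarrow> complex mat) \<Rightarrow> nat \<Rightarrow> nat \<Rightarrow> complex" where
  "block_entries n m V r x \<equiv> block_col n m V $$ (r, x)"

lemma compression_eq_kraus1:
  assumes T: "T \<in> carrier_mat (n * m) (n * m)"
  shows "mat_adjoint (block_col n m V) * T * block_col n m V = kraus1 (n * m) m (block_entries n m V) T"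
proof (rule eq_matI)
  let ?W = "block_col n m V"
  have dim: "dim_row ?W = n * m" "dim_col ?W = m" by (simp_all add: block_col_def)
  fix x y
  assume "x < dim_row (kraus1 (n * m) m (block_entries n m V) T)"
    "y < dim_col (kraus1 (n * m) m (block_entries n m V) T)"
  then have xy: "x < m" "y < m" by (simp_all add: kraus_def)
  have "(mat_adjoint ?W * T * ?W) $$ (x, y)
      = (\<Sum>b<n * m. (\<Sum>a<n * m. cnj (?W $$ (a, x)) * T $$ (a, b)) * ?W $$ (b, y))"
    using xy T by (simp add: scalar_prod_def dim mat_adjoint_dim mat_adjoint_index lessThan_atLeast0)
  also have "\<dots> = (\<Sum>b<n * m. \<Sum>a<n * m. cnj (?W $$ (a, x)) * T $$ (a, b) * ?W $$ (b, y))"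
    by (simp only: sum_distrib_right)
  also have "\<dots> = kraus1 (n * m) m (block_entries n m V) T $$ (x, y)"
    unfolding kraus_index[OF xy] by (subst sum.swap) simp
  finally show "(mat_adjoint ?W * T * ?W) $$ (x, y) = kraus1 (n * m) m (block_entries n m V) T $$ (x, y)" .
qed (simp_all add: kraus_def mat_adjoint_dim block_col_def)

lemma Q_poly_eq_col_poly:
  assumes "a < m" "x < m"
  shows "Q_poly n m V $$ (a, x) = col_poly n m (block_entries n m V) (a, x)"
proof (rule poly_eqI)
  fix k
  show "coeff (Q_poly n m V $$ (a, x)) k = coeff (col_poly n m (block_entries n m V) (a, x)) k"
    using assms block_index_less[of "n - 1 - k" n a m]
    by (simp add: coeff_Q_poly coeff_col_poly block_col_def Suc_diff_Suc)
qed

lemma roots_on_circle_block_entries: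
  assumes n: "1 \<le> n" and V: "\<And>i. i \<in> {1..n} \<Longrightarrow> V i \<in> carrier_mat m m"
  shows "roots_on_circle n m (block_entries n m V)
    \<longleftrightarrow> has_degree (Q_poly n m V) (n - 1) \<and> matpoly_roots (Q_poly n m V) \<subseteq> {z. cmod z = 1}"
proof -
  have V1: "V 1 \<in> carrier_mat m m" using V n by simp
  have "block_entries n m V a x = V 1 $$ (a, x)" if "a < m" "x < m" for a x
    using block_index_less[of 0 n a m] that n by (simp add: block_col_def)
  then have "(\<exists>a<m. \<exists>x<m. block_entries n m V a x \<noteq> 0) \<longleftrightarrow> (\<exists>a<m. \<exists>x<m. V 1 $$ (a, x) \<noteq> 0)"
    by metis
  also have "\<dots> \<longleftrightarrow> V 1 \<noteq> 0\<^sub>m m m"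
  proof
    assume "V 1 \<noteq> 0\<^sub>m m m"
    then show "\<exists>a<m. \<exists>x<m. V 1 $$ (a, x) \<noteq> 0" using V1 by (metis carrier_matD eq_matI index_zero_mat)
  qed auto
  also have "\<dots> \<longleftrightarrow> has_degree (Q_poly n m V) (n - 1)"
    using has_degree_Q_poly_iff[where V = V, OF n V1] by simp
  finally have deg: "(\<exists>a<m. \<exists>x<m. block_entries n m V a x \<noteq> 0) \<longleftrightarrow> has_degree (Q_poly n m V) (n - 1)" .
  have dim: "dim_row (Q_poly n m V) = m" "dim_col (Q_poly n m V) = m" by (simp_all add: Q_poly_def)
  have "z \<in> matpoly_roots (Q_poly n m V)
      \<longleftrightarrow> (\<forall>a<m. \<forall>x<m. poly (col_poly n m (block_entries n m V) (a, x)) z = 0)" for z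
  proof -
    have "z \<in> matpoly_roots (Q_poly n m V) \<longleftrightarrow> eval_matpoly (Q_poly n m V) z = 0\<^sub>m m m"
      by (simp add: matpoly_roots_def dim)
    also have "\<dots> \<longleftrightarrow> (\<forall>a<m. \<forall>x<m. eval_matpoly (Q_poly n m V) z $$ (a, x) = 0)"
    proof
      assume "\<forall>a<m. \<forall>x<m. eval_matpoly (Q_poly n m V) z $$ (a, x) = 0"
      then show "eval_matpoly (Q_poly n m V) z = 0\<^sub>m m m"
        by (intro eq_matI) (auto simp: eval_matpoly_def dim)
    qed simp
    also have "\<dots> \<longleftrightarrow> (\<forall>a<m. \<forall>x<m. poly (col_poly n m (block_entries n m V) (a, x)) z = 0)"
      by (simp add: eval_matpoly_def dim Q_poly_eq_col_poly)
    finally show ?thesis .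
  qed
  then show ?thesis unfolding roots_on_circle_def deg by auto
qed

lemma isometry_block_col_iff_kraus1:
  "isometry (block_col n m V) \<longleftrightarrow> kraus1 (n * m) m (block_entries n m V) (1\<^sub>m (n * m)) = 1\<^sub>m m"
proof -
  have C: "mat_adjoint (block_col n m V) \<in> carrier_mat m (n * m)"
    by (intro carrier_matI) (simp_all add: mat_adjoint_dim block_col_def)
  have "isometry (block_col n m V) \<longleftrightarrow> mat_adjoint (block_col n m V) * block_col n m V = 1\<^sub>m m"
    by (simp add: isometry_def block_col_def)
  also have "mat_adjoint (block_col n m V) * block_col n m V
      = mat_adjoint (block_col n m V) * 1\<^sub>m (n * m) * block_col n m V"
    using C by simp
  finally show ?thesis unfolding compression_eq_kraus1[OF one_carrier_mat] .
qed

lemma block_entries_of_blocks: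
  assumes "r < n * m" "x < m"
  shows "block_entries n m (\<lambda>i. mat m m (\<lambda>(a, x). V ((i - 1) * m + a) x)) r x = V r x"
  using assms by (simp add: block_col_def)

lemma kraus1_cong:
  assumes "\<And>r x. r < d \<Longrightarrow> x < m \<Longrightarrow> V r x = V' r x"
  shows "kraus1 d m V X = kraus1 d m V' X"
  using assms by (intro eq_matI) (auto simp: kraus_def intro!: sum.cong)

section \<open>The three characterisations of purity\<close>

lemma pure_iff_isometric_compression:
  assumes nm: "0 < n" "0 < m" and ucp: "ucp (n * m) (block_toeplitz n m) m \<phi>"
  shows "pure (n * m) (block_toeplitz n m) m \<phi> \<longleftrightarrow>
    (\<exists>V. (\<forall>i\<in>{1..n}. V i \<in> carrier_mat m m) \<and>
       isometry (block_col n m V) \<and>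
       (\<forall>T\<in>block_toeplitz n m. \<phi> T = mat_adjoint (block_col n m V) * T * block_col n m V) \<and>
       has_degree (Q_poly n m V) (n - 1) \<and>
       matpoly_roots (Q_poly n m V) \<subseteq> {z. cmod z = 1})"
    (is "?pure \<longleftrightarrow> (\<exists>V. ?P V)")
proof
  note OS = operator_system_block_toeplitz[of n m]
  have nm': "0 < n * m" "1 \<le> n" using nm by simp_all
  have one: "\<phi> (1\<^sub>m (n * m)) = 1\<^sub>m m" using ucp unfolding ucp_def by blast
  {
    assume pure: ?pure
    from pure_imp_kraus1[OF OS nm'(1) nm(2) ucp pure] obtain V
      where V: "\<And>T. T \<in> block_toeplitz n m \<Longrightarrow> \<phi> T = kraus1 (n * m) m V T" by blast
    define B where "B i = mat m m (\<lambda>(a, x). V ((i - 1) * m + a) x)" for i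
    have B: "\<phi> T = kraus1 (n * m) m (block_entries n m B) T" if "T \<in> block_toeplitz n m" for T
      unfolding V[OF that] by (rule kraus1_cong) (simp only: B_def[abs_def] block_entries_of_blocks)
    have "B i \<in> carrier_mat m m" for i by (simp add: B_def)
    moreover have "isometry (block_col n m B)"
      unfolding isometry_block_col_iff_kraus1 B[OF one_in_toeplitz, symmetric] by (rule one)
    moreover have "roots_on_circle n m (block_entries n m B)"
      by (rule pure_imp_roots_on_circle[OF nm B one pure])
    ultimately have "?P B"
      using B roots_on_circle_block_entries[OF nm'(2), of B m] compression_eq_kraus1[OF toeplitz_carrier] by auto
    then show "\<exists>V. ?P V" by (rule exI[of _ B])
  next
    assume "\<exists>V. ?P V"
    then obtain V where V: "?P V" by (elim exE)
    show ?pure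
    proof (rule pure_of_roots_on_circle[where \<phi> = \<phi>, OF nm _ OS subset_refl _ one])
      show "roots_on_circle n m (block_entries n m V)"
        using V roots_on_circle_block_entries[OF nm'(2), of V m] by blast
      show "\<phi> T = kraus1 (n * m) m (block_entries n m V) T" if "T \<in> block_toeplitz n m" for T
        using V that compression_eq_kraus1[OF toeplitz_carrier[OF that]] by simp
    qed
  }
qed

lemma extension_of_pure:
  assumes nm: "0 < n" "0 < m" and ucp: "ucp (n * m) (block_toeplitz n m) m \<phi>"
    and pure: "pure (n * m) (block_toeplitz n m) m \<phi>"
  obtains \<Phi> where "ucp (n * m) (carrier_mat (n * m) (n * m)) m \<Phi>"
    and "\<And>T. T \<in> block_toeplitz n m \<Longrightarrow> \<Phi> T = \<phi> T"
    and "\<And>\<Psi> X. ucp (n * m) (carrier_mat (n * m) (n * m)) m \<Psi> \<Longrightarrow>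
           (\<And>T. T \<in> block_toeplitz n m \<Longrightarrow> \<Psi> T = \<phi> T) \<Longrightarrow>
           X \<in> carrier_mat (n * m) (n * m) \<Longrightarrow> \<Psi> X = \<Phi> X"
    and "pure (n * m) (carrier_mat (n * m) (n * m)) m \<Phi>"
proof -
  note OS = operator_system_block_toeplitz[of n m]
  have nm': "0 < n * m" using nm by simp
  have one: "\<phi> (1\<^sub>m (n * m)) = 1\<^sub>m m" using ucp unfolding ucp_def by blast
  from pure_imp_kraus1[OF OS nm' nm(2) ucp pure] obtain V
    where V: "\<And>T. T \<in> block_toeplitz n m \<Longrightarrow> \<phi> T = kraus1 (n * m) m V T" by blast
  let ?\<Phi> = "kraus1 (n * m) m V"
  have roots: "roots_on_circle n m V" by (rule pure_imp_roots_on_circle[OF nm V one pure])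
  have \<Phi>1: "?\<Phi> (1\<^sub>m (n * m)) = 1\<^sub>m m" using V[OF one_in_toeplitz] one by simp
  show thesis
  proof (rule that[of ?\<Phi>])
    show "ucp (n * m) (carrier_mat (n * m) (n * m)) m ?\<Phi>"
      unfolding ucp_def using completely_positive_kraus[OF operator_system_carrier nm' nm(2) refl] \<Phi>1 by blast
    show "?\<Phi> T = \<phi> T" if "T \<in> block_toeplitz n m" for T using V[OF that] by simp
    show "\<Psi> X = ?\<Phi> X"
      if "ucp (n * m) (carrier_mat (n * m) (n * m)) m \<Psi>"
        "\<And>T. T \<in> block_toeplitz n m \<Longrightarrow> \<Psi> T = \<phi> T" "X \<in> carrier_mat (n * m) (n * m)" for \<Psi> X
      by (rule unique_extension_of_roots_on_circle[OF nm roots that(1) _ that(3)]) (use that(2) V in auto)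
    show "pure (n * m) (carrier_mat (n * m) (n * m)) m ?\<Phi>"
      by (rule pure_of_roots_on_circle[where \<phi> = "?\<Phi>", OF nm roots operator_system_carrier _ refl \<Phi>1])
        (use toeplitz_carrier in blast)
  qed
qed

text \<open>Both \<open>\<psi>\<close> and \<open>\<phi> - \<psi>\<close> extend through their Kraus decompositions. The sum of the extensions is a ucp
extension of \<open>\<phi>\<close>, so it equals \<open>\<Phi>\<close>, and purity of \<open>\<Phi>\<close> applies to the extension of \<open>\<psi>\<close>.\<close>

lemma pure_of_unique_pure_extension:
  assumes S: "operator_system d S" and dm: "0 < d" "0 < m"
    and \<Phi>: "ucp d (carrier_mat d d) m \<Phi>" and ext: "\<And>X. X \<in> S \<Longrightarrow> \<Phi> X = \<phi> X"
    and unique: "\<And>\<Psi> X. ucp d (carrier_mat d d) m \<Psi> \<Longrightarrow> (\<And>Y. Y \<in> S \<Longrightarrow> \<Psi> Y = \<phi> Y) \<Longrightarrow>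
           X \<in> carrier_mat d d \<Longrightarrow> \<Psi> X = \<Phi> X"
    and pure: "pure d (carrier_mat d d) m \<Phi>"
  shows "pure d S m \<phi>"
  unfolding pure_def
proof (intro allI impI)
  fix \<psi> assume cp: "completely_positive d S m \<psi> \<and> completely_positive d S m (\<lambda>X. \<phi> X - \<psi> X)"
  note OC = operator_system_carrier[of d]
  have SC: "X \<in> carrier_mat d d" if "X \<in> S" for X using S that unfolding operator_system_def by blast
  have 1: "1\<^sub>m d \<in> S" using S unfolding operator_system_def by blast
  have \<phi>C: "\<phi> X \<in> carrier_mat m m" if "X \<in> S" for X
    using \<Phi> SC[OF that] ext[OF that] unfolding ucp_def completely_positive_def linear_map_on_def by metis
  obtain L W L' W' where W: "\<And>X. X \<in> S \<Longrightarrow> \<psi> X = kraus d m L W X"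
    and U: "\<And>X. X \<in> S \<Longrightarrow> \<phi> X = kraus d m (L + L') (\<lambda>l. if l < L then W l else W' (l - L)) X"
    using kraus_of_dominated[where \<phi> = \<phi>, OF S dm \<phi>C conjunct1[OF cp] conjunct2[OF cp]] by blast
  define \<Psi> where "\<Psi> = kraus d m (L + L') (\<lambda>l. if l < L then W l else W' (l - L))"
  have \<Psi>_ext: "\<Psi> X = \<phi> X" if "X \<in> S" for X
    unfolding \<Psi>_def using U[OF that] by simp
  have "completely_positive d (carrier_mat d d) m \<Psi>"
    unfolding \<Psi>_def by (rule completely_positive_kraus[OF OC dm refl])
  then have "ucp d (carrier_mat d d) m \<Psi>"
    unfolding ucp_def using \<Psi>_ext[OF 1] ext[OF 1] \<Phi> unfolding ucp_def by simp
  then have \<Psi>\<Phi>: "\<Psi> X = \<Phi> X" if "X \<in> carrier_mat d d" for X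
    using unique \<Psi>_ext that by blast
  have "completely_positive d (carrier_mat d d) m (kraus d m L W)"
    by (rule completely_positive_kraus[OF OC dm refl])
  moreover have "completely_positive d (carrier_mat d d) m (\<lambda>X. \<Phi> X - kraus d m L W X)"
  proof (rule completely_positive_kraus[OF OC dm])
    show "\<Phi> X - kraus d m L W X = kraus d m L' W' X" if "X \<in> carrier_mat d d" for X
      unfolding \<Psi>\<Phi>[OF that, symmetric] \<Psi>_def kraus_append
      by (intro eq_matI) (simp_all add: kraus_def)
  qed
  ultimately obtain t :: real where t: "0 \<le> t" "t \<le> 1"
    "\<And>X. X \<in> carrier_mat d d \<Longrightarrow> kraus d m L W X = complex_of_real t \<cdot>\<^sub>m \<Phi> X"
    using pure unfolding pure_def by metis
  have "\<psi> X = complex_of_real t \<cdot>\<^sub>m \<phi> X" if "X \<in> S" for X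
    using t(3)[OF SC[OF that]] W[OF that] ext[OF that] by simp
  then show "\<exists>t::real. 0 \<le> t \<and> t \<le> 1 \<and> (\<forall>X\<in>S. \<psi> X = complex_of_real t \<cdot>\<^sub>m \<phi> X)"
    using t by blast
qed

theorem theorem1:
  fixes n m :: nat and \<phi> :: "complex mat \<Rightarrow> complex mat"
  assumes "1 \<le> n" and "1 \<le> m"
    and "ucp (n * m) (block_toeplitz n m) m \<phi>"
  shows "(pure (n * m) (block_toeplitz n m) m \<phi> \<longleftrightarrow>
      (\<exists>\<Phi>. ucp (n * m) (carrier_mat (n * m) (n * m)) m \<Phi> \<and>
           (\<forall>T\<in>block_toeplitz n m. \<Phi> T = \<phi> T) \<and>
           (\<forall>\<Psi>. ucp (n * m) (carrier_mat (n * m) (n * m)) m \<Psi> \<and>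
                (\<forall>T\<in>block_toeplitz n m. \<Psi> T = \<phi> T) \<longrightarrow>
                (\<forall>X\<in>carrier_mat (n * m) (n * m). \<Psi> X = \<Phi> X)) \<and>
           pure (n * m) (carrier_mat (n * m) (n * m)) m \<Phi>)) \<and>
    (pure (n * m) (block_toeplitz n m) m \<phi> \<longleftrightarrow>
      (\<exists>V. (\<forall>i\<in>{1..n}. V i \<in> carrier_mat m m) \<and>
           isometry (block_col n m V) \<and>
           (\<forall>T\<in>block_toeplitz n m.
              \<phi> T = mat_adjoint (block_col n m V) * T * block_col n m V) \<and>
           has_degree (Q_poly n m V) (n - 1) \<and>
           matpoly_roots (Q_poly n m V) \<subseteq> {z. cmod z = 1}))"
    (is "(?pure \<longleftrightarrow> (\<exists>\<Phi>. ?E \<Phi>)) \<and> ?iii")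
proof (intro conjI iffI)
  have nm: "0 < n" "0 < m" "0 < n * m" using assms(1,2) by simp_all
  show "\<exists>\<Phi>. ?E \<Phi>" if pure: ?pure
  proof -
    obtain \<Phi> where "ucp (n * m) (carrier_mat (n * m) (n * m)) m \<Phi>"
      "\<And>T. T \<in> block_toeplitz n m \<Longrightarrow> \<Phi> T = \<phi> T"
      "\<And>\<Psi> X. ucp (n * m) (carrier_mat (n * m) (n * m)) m \<Psi> \<Longrightarrow>
           (\<And>T. T \<in> block_toeplitz n m \<Longrightarrow> \<Psi> T = \<phi> T) \<Longrightarrow>
           X \<in> carrier_mat (n * m) (n * m) \<Longrightarrow> \<Psi> X = \<Phi> X"
      "pure (n * m) (carrier_mat (n * m) (n * m)) m \<Phi>"
      using extension_of_pure[OF nm(1,2) assms(3) pure] by blast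
    then show ?thesis by (intro exI[of _ \<Phi>]) blast
  qed
  show ?pure if ex: "\<exists>\<Phi>. ?E \<Phi>"
  proof -
    from ex obtain \<Phi> where \<Phi>: "?E \<Phi>" by (elim exE)
    show ?thesis
      by (rule pure_of_unique_pure_extension[OF operator_system_block_toeplitz nm(3,2), of \<Phi>]) (use \<Phi> in blast)+
  qed
qed (use pure_iff_isometric_compression[OF _ _ assms(3)] assms(1,2) in simp_all)

end
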